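(* Let $\Omega\subset\mathbb{R}^n$ be an open bounded set, $x_0\in\Omega$, $\ell=\operatorname{diam}\Omega$, let $p\in WL(\Omega)$ satisfy $1<p_-\le p(x)\le p_+<\infty$, and let the functions $\omega_1$ and $\omega_2$ satisfy $$\int_0^t\omega_1(r)\frac{dr}{r}\le C\,\omega_2(t),\qquad 0<t<\ell,$$ where $C$ does not depend on $t$. Then the maximal operator $M$ is bounded from ${}^{\complement}\mathcal{M}^{p(\cdot),\omega_1}_{\{x_0\}}(\Omega)$ to ${}^{\complement}\mathcal{M}^{p(\cdot),\omega_2}_{\{x_0\}}(\Omega)$.
   Context: $B(x,r)$ is the open ball in $\mathbb{R}^n$, $\widetilde B(x,r)=B(x,r)\cap\Omega$. For measurable $p:\Omega\to[1,\infty)$: $p_-=\operatorname{ess\,inf}_\Omega p$, $p_+=\operatorname{ess\,sup}_\Omega p$, $p'(x)=\frac{p(x)}{p(x)-1}$. $L^{p(\cdot)}(E)$ is the variable exponent Lebesgue space with the Luxemburg norm $\|f\|_{L^{p(\cdot)}(E)}=\inf\{\eta>0:\int_E|f(x)/\eta|^{p(x)}dx\le1\}$. $WL(\Omega)$ is the class of functions on $\Omega$ with $|p(x)-p(y)|\le\frac{A}{-\ln|x-y|}$ for all $x,y\in\Omega$, $|x-y|\le\frac12$, with $A>0$ independent of $x,y$. The functions $\omega,\omega_1,\omega_2$ are non-negative and measurable on $(0,\ell)$ and bounded outside any neighbourhood $(0,\delta)$ of the origin. The variable exponent generalized local "complementary" Morrey space ${}^{\complement}\mathcal{M}^{p(\cdot),\omega}_{\{x_0\}}(\Omega)$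 is defined by the norm $$\|f\|_{{}^{\complement}\mathcal{M}^{p(\cdot),\omega}_{\{x_0\}}(\Omega)}=\sup_{0<r<\ell}\frac{r^{n/p'(x_0)}}{\omega(r)}\|f\|_{L^{p(\cdot)}(\Omega\setminus\widetilde B(x_0,r))}.$$ Standing assumption for each such space: $\sup_{0<r<\ell}\frac{r^{n/p'(x_0)}}{\omega(r)}<\infty$ (in particular $\omega>0$). The Hardy–Littlewood maximal operator is $Mf(x)=\sup_{r>0}\frac1{|B(x,r)|}\int_{\widetilde B(x,r)}|f(y)|\,dy$. Boundedness means $\|Mf\|\le C\|f\|$ with $C$ independent of $f$. *)

theory Defs
  imports "HOL-Analysis.Analysis" "HOL-Probability.Essential_Supremum"
begin

(* Functions on a set Omega are total functions on the ambient Euclidean space; every notion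
   below depends only on their values on Omega. *)

definition ess_sup_on :: "'a::euclidean_space set \<Rightarrow> ('a \<Rightarrow> real) \<Rightarrow> ereal" where
  "ess_sup_on \<Omega> p = esssup (lebesgue_on \<Omega>) (\<lambda>x. ereal (p x))"

(* The library provides only the essential supremum; ess inf p = - ess sup (- p). *)
definition ess_inf_on :: "'a::euclidean_space set \<Rightarrow> ('a \<Rightarrow> real) \<Rightarrow> ereal" where
  "ess_inf_on \<Omega> p = - esssup (lebesgue_on \<Omega>) (\<lambda>x. - ereal (p x))"

definition conj_exponent :: "('a \<Rightarrow> real) \<Rightarrow> 'a \<Rightarrow> real" where
  "conj_exponent p x = p x / (p x - 1)"

(* For x = y the inequality holds trivially, since ln 0 = 0 and division by 0 gives 0. *)
definition WL :: "'a::euclidean_space set \<Rightarrow> ('a \<Rightarrow> real) set" where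
  "WL \<Omega> = {p. \<exists>A>0. \<forall>x\<in>\<Omega>. \<forall>y\<in>\<Omega>. norm (x - y) \<le> 1/2 \<longrightarrow>
                 \<bar>p x - p y\<bar> \<le> A / (- ln (norm (x - y)))}"

(* The norms take values in [0, \<infinity>]; the infimum over the empty set is \<infinity>. *)
definition luxemburg_norm ::
    "('a::euclidean_space \<Rightarrow> real) \<Rightarrow> 'a set \<Rightarrow> ('a \<Rightarrow> real) \<Rightarrow> ennreal" where
  "luxemburg_norm p E f =
     Inf {ennreal \<eta> | \<eta>. \<eta> > 0 \<and> (\<integral>\<^sup>+x\<in>E. ennreal (\<bar>f x / \<eta>\<bar> powr p x) \<partial>lebesgue) \<le> 1}"

definition weight_function :: "real \<Rightarrow> (real \<Rightarrow> real) \<Rightarrow> bool" where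
  "weight_function l \<omega> \<longleftrightarrow>
     \<omega> \<in> borel_measurable (lebesgue_on {0<..<l}) \<and>
     (\<forall>r\<in>{0<..<l}. 0 \<le> \<omega> r) \<and>
     (\<forall>\<delta>>0. bounded (\<omega> ` {\<delta>..<l}))"

(* Positivity is stated explicitly because division by 0 gives 0 in HOL,
   whereas finiteness of the supremum is meant to exclude zeros of \<omega>. *)
definition admissible_weight ::
    "('a::euclidean_space \<Rightarrow> real) \<Rightarrow> 'a set \<Rightarrow> 'a \<Rightarrow> (real \<Rightarrow> real) \<Rightarrow> bool" where
  "admissible_weight p \<Omega> x0 \<omega> \<longleftrightarrow>
     weight_function (diameter \<Omega>) \<omega> \<and>
     (\<forall>r\<in>{0<..<diameter \<Omega>}. 0 < \<omega> r) \<and>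
     (SUP r\<in>{0<..<diameter \<Omega>}.
        ennreal (r powr (real DIM('a) / conj_exponent p x0) / \<omega> r)) < \<infinity>"

definition compl_morrey_norm ::
    "('a::euclidean_space \<Rightarrow> real) \<Rightarrow> (real \<Rightarrow> real) \<Rightarrow> 'a \<Rightarrow> 'a set \<Rightarrow> ('a \<Rightarrow> real) \<Rightarrow> ennreal" where
  "compl_morrey_norm p \<omega> x0 \<Omega> f =
     (SUP r\<in>{0<..<diameter \<Omega>}.
        ennreal (r powr (real DIM('a) / conj_exponent p x0) / \<omega> r) *
        luxemburg_norm p (\<Omega> - (ball x0 r \<inter> \<Omega>)) f)"

definition compl_morrey_space ::
    "('a::euclidean_space \<Rightarrow> real) \<Rightarrow> (real \<Rightarrow> real) \<Rightarrow> 'a \<Rightarrow> 'a set \<Rightarrow> ('a \<Rightarrow> real) set" where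
  "compl_morrey_space p \<omega> x0 \<Omega> =
     {f. f \<in> borel_measurable (lebesgue_on \<Omega>) \<and> compl_morrey_norm p \<omega> x0 \<Omega> f < \<infinity>}"

definition maximal_op :: "'a::euclidean_space set \<Rightarrow> ('a \<Rightarrow> real) \<Rightarrow> 'a \<Rightarrow> ennreal" where
  "maximal_op \<Omega> f x =
     (SUP r\<in>{0<..}. (\<integral>\<^sup>+y\<in>ball x r \<inter> \<Omega>. ennreal \<bar>f y\<bar> \<partial>lebesgue) / emeasure lebesgue (ball x r))"

(* Since M f may a priori be infinite, almost everywhere finiteness on Omega is part of
   boundedness; it makes the passage to real values by enn2real (which sends \<infinity> to 0) harmless. *)
definition maximal_op_bounded ::
    "('a::euclidean_space \<Rightarrow> real) \<Rightarrow> 'a \<Rightarrow> 'a set \<Rightarrow> (real \<Rightarrow> real) \<Rightarrow> (real \<Rightarrow> real) \<Rightarrow> bool" where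
  "maximal_op_bounded p x0 \<Omega> \<omega>1 \<omega>2 \<longleftrightarrow>
     (\<exists>C::real. C > 0 \<and> (\<forall>f\<in>compl_morrey_space p \<omega>1 x0 \<Omega>.
        (AE x in lebesgue_on \<Omega>. maximal_op \<Omega> f x < \<infinity>) \<and>
        (\<lambda>x. enn2real (maximal_op \<Omega> f x)) \<in> compl_morrey_space p \<omega>2 x0 \<Omega> \<and>
        compl_morrey_norm p \<omega>2 x0 \<Omega> (\<lambda>x. enn2real (maximal_op \<Omega> f x))
          \<le> ennreal C * compl_morrey_norm p \<omega>1 x0 \<Omega> f))"

end

theory Submission
  imports Defs
begin

text \<open>
The proof reduces the complementary Morrey estimate to boundedness of the maximal operator on the
variable exponent Lebesgue space over \<open>\<Omega>\<close>, applied to a single rearranged function for each radius.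

Fix \<open>t\<close> below the diameter and look at \<open>M f\<close> at points at distance at least \<open>t\<close> from \<open>x0\<close>.
Such a point sees the part of \<open>f\<close> inside \<open>ball x0 (t/2)\<close> only through balls so large that their
threefold enlargement contains all of \<open>ball x0 (t/2)\<close>. Hence that part may be replaced by any function
there of at least the same integral, and \<open>M f \<le> 3^n M h\<close>
(\<open>HL_maximal_le_redistribution\<close>), where \<open>h\<close> agrees with \<open>f\<close> away from \<open>ball x0 (t/2)\<close> and
has the mass of \<open>f\<close> on \<open>ball x0 (t/2)\<close> spread evenly over a ball around \<open>x0\<close> of radius proportional to \<open>t\<close>
that lies in \<open>\<Omega>\<close>. It remains to bound the norm of \<open>h\<close> by \<open>\<omega>2 t * t powr (-\<beta>)\<close> times
the Morrey norm of \<open>f\<close>, with \<open>\<beta> = n / p'(x0)\<close>; this is \<open>maximal_op_complement_bound\<close>.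

Both pieces of \<open>h\<close> are controlled by the Hardy condition on the weights. The norm of the far piece is
at most \<open>\<omega>1 s * s powr (-\<beta>)\<close> times the Morrey norm for every \<open>s < t/2\<close>, and the condition forces
\<open>\<omega>1 s\<close> to be comparable to \<open>\<omega>2 t\<close> or smaller for some \<open>s\<close> between \<open>t/4\<close> and \<open>t/2\<close>
(\<open>modular_far_part_le_1\<close>). The mass of the near piece is a sum over dyadic annuli. On an annulus at distance
about \<open>s\<close>, Hoelder's inequality gives at most \<open>s powr \<beta>\<close> times the norm of \<open>f\<close> outside \<open>ball x0 s\<close>,
that is a multiple of \<open>\<omega>1 s\<close>; averaging over the dyadic scale with respect to \<open>ds/s\<close> and
summing produces the Hardy integral (\<open>set_nn_integral_near_part_le\<close>). In all these estimates
log-Hoelder continuity enters in the form that \<open>\<rho> powr (p x - p y)\<close> is bounded whenever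
\<open>x\<close> and \<open>y\<close> are within distance \<open>\<rho>\<close>, so that \<open>p y\<close> may be replaced by \<open>p x0\<close> on the ball of
radius \<open>\<rho>\<close>.

Boundedness of \<open>M\<close> on the variable exponent space (\<open>maximal_op_modular_bound\<close>) follows Diening.
If the modular of \<open>f\<close> is at most 1, the averages of \<open>u = \<bar>f\<bar> powr (p / p\<^sub>m)\<close> over balls of radius
\<open>\<rho>\<close> grow at most like a negative power of \<open>\<rho>\<close>, so log-Hoelder continuity gives
\<open>M f \<le> D * (1 + M u) powr (p\<^sub>m / p)\<close> pointwise (\<open>maximal_op_pointwise_bound\<close>). Raising to the power
\<open>p\<close> leaves the classical inequality for the constant exponent \<open>p\<^sub>m > 1\<close>
(\<open>HL_maximal_strong_type\<close>), which comes from Vitali's covering lemma by dyadic interpolation.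
\<close>

section \<open>The weak-type inequality for the maximal function\<close>

definition HL_maximal :: "('a::euclidean_space \<Rightarrow> ennreal) \<Rightarrow> 'a \<Rightarrow> ennreal" where
  "HL_maximal g x =
     (SUP r\<in>{0<..}. (\<integral>\<^sup>+y\<in>ball x r. g y \<partial>lebesgue) / emeasure lebesgue (ball x r))"

lemma maximal_op_eq_HL_maximal:
  "maximal_op \<Omega> f = HL_maximal (\<lambda>y. ennreal \<bar>f y\<bar> * indicator \<Omega> y)"
  unfolding maximal_op_def HL_maximal_def
  by (simp add: indicator_inter_arith mult_ac)

abbreviation vol1 :: "'a::euclidean_space itself \<Rightarrow> real" where
  "vol1 _ \<equiv> unit_ball_vol (real DIM('a))"

lemma emeasure_lebesgue_ball:
  fixes x :: "'a::euclidean_space"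
  assumes "0 \<le> r"
  shows "emeasure lebesgue (ball x r) = ennreal (vol1 TYPE('a) * r ^ DIM('a))"
  using emeasure_ball[OF assms, of x] by simp

lemma vol1_pos: "0 < vol1 TYPE('a::euclidean_space)"
  by simp

lemma ennreal_divide_le_iff:
  assumes "0 < v"
  shows "z / ennreal v \<le> c \<longleftrightarrow> z \<le> c * ennreal v"
proof
  assume "z / ennreal v \<le> c"
  then have "z / ennreal v * ennreal v \<le> c * ennreal v" by (rule mult_right_mono) simp
  moreover have "z / ennreal v * ennreal v = z"
    using assms by (simp add: ennreal_divide_times mult_divide_eq_ennreal)
  ultimately show "z \<le> c * ennreal v" by simp
next
  assume "z \<le> c * ennreal v"
  then show "z / ennreal v \<le> c"
    using assms by (intro divide_le_posI_ennreal) (auto simp: mult.commute)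
qed

lemma HL_maximal_le_iff:
  fixes g :: "'a::euclidean_space \<Rightarrow> ennreal"
  shows "HL_maximal g x \<le> c \<longleftrightarrow>
    (\<forall>r>0. (\<integral>\<^sup>+y\<in>ball x r. g y \<partial>lebesgue) \<le> c * emeasure lebesgue (ball x r))"
proof -
  have "(\<integral>\<^sup>+y\<in>ball x r. g y \<partial>lebesgue) / emeasure lebesgue (ball x r) \<le> c \<longleftrightarrow>
     (\<integral>\<^sup>+y\<in>ball x r. g y \<partial>lebesgue) \<le> c * emeasure lebesgue (ball x r)" if "0 < r" for r
    using that vol1_pos[where 'a='a] by (simp only: emeasure_lebesgue_ball less_imp_le) (rule ennreal_divide_le_iff, simp)
  then show ?thesis unfolding HL_maximal_def SUP_le_iff by auto
qed

lemma less_HL_maximal_iff: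
  fixes g :: "'a::euclidean_space \<Rightarrow> ennreal"
  shows "c < HL_maximal g x \<longleftrightarrow>
    (\<exists>r>0. c * emeasure lebesgue (ball x r) < (\<integral>\<^sup>+y\<in>ball x r. g y \<partial>lebesgue))"
  using HL_maximal_le_iff[of g x c] by (auto simp: not_le[symmetric])

text \<open>An open ball is the increasing union of concentric smaller ones. The room gained is what makes the
superlevel sets of the maximal function open: a slightly smaller ball around \<open>x\<close> stays inside the
ball of the original radius around any nearby centre.\<close>
lemma set_nn_integral_ball_approximated_from_inside:
  fixes g :: "'a::euclidean_space \<Rightarrow> ennreal"
  assumes g: "g \<in> borel_measurable lebesgue" and r: "0 < r"
    and c: "c < (\<integral>\<^sup>+y\<in>ball x r. g y \<partial>lebesgue)"
  obtains s where "0 < s" "s < r" "c < (\<integral>\<^sup>+y\<in>ball x s. g y \<partial>lebesgue)"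
proof -
  let ?s = "\<lambda>n. r - r / (real n + 2)"
  have inc: "incseq (\<lambda>n. ball x (?s n))"
  proof (rule incseq_SucI)
    fix n
    have "r / (real (Suc n) + 2) \<le> r / (real n + 2)" using r by (intro divide_left_mono) auto
    then show "ball x (?s n) \<subseteq> ball x (?s (Suc n))" by (intro subset_ball) simp
  qed
  have un: "(\<Union>n. ball x (?s n)) = ball x r"
  proof (intro equalityI subsetI)
    fix y assume "y \<in> (\<Union>n. ball x (?s n))"
    then obtain n where "dist x y < ?s n" by auto
    moreover have "r / (real n + 2) > 0" using r by auto
    ultimately show "y \<in> ball x r" by auto
  next
    fix y assume "y \<in> ball x r"
    then have d: "r - dist x y > 0" by simp
    obtain n :: nat where "r / (r - dist x y) < real n" using reals_Archimedean2 by blast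
    then have "r < real n * (r - dist x y)" using d by (simp add: divide_less_eq)
    also have "\<dots> \<le> (real n + 2) * (r - dist x y)" using d by (intro mult_right_mono) auto
    finally have "r / (real n + 2) < r - dist x y"
      by (simp add: divide_less_eq mult.commute)
    then show "y \<in> (\<Union>n. ball x (?s n))" by (auto intro!: exI[of _ n])
  qed
  have *: "(\<integral>\<^sup>+y\<in>A. g y \<partial>lebesgue) = emeasure (density lebesgue g) A" if "A \<in> sets lebesgue" for A
    using emeasure_density[OF g that] by simp
  have "(SUP n. emeasure (density lebesgue g) (ball x (?s n))) = emeasure (density lebesgue g) (ball x r)"
    using SUP_emeasure_incseq[of "\<lambda>n. ball x (?s n)" "density lebesgue g", OF _ inc]
    by (simp add: un image_subset_iff)
  then have "c < (SUP n. emeasure (density lebesgue g) (ball x (?s n)))" using c by (simp add: *)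
  then obtain n where "c < emeasure (density lebesgue g) (ball x (?s n))" unfolding less_SUP_iff by auto
  then have "c < (\<integral>\<^sup>+y\<in>ball x (?s n). g y \<partial>lebesgue)" by (simp add: *)
  moreover have "0 < r * (real n + 1)" using r by (intro mult_pos_pos) auto
  then have "?s n < r" "0 < ?s n" using r by (auto simp: field_simps)
  ultimately show ?thesis using that by blast
qed

lemma open_HL_maximal_greater:
  fixes g :: "'a::euclidean_space \<Rightarrow> ennreal"
  assumes g: "g \<in> borel_measurable lebesgue"
  shows "open {x. c < HL_maximal g x}"
  unfolding open_contains_ball
proof
  fix x assume "x \<in> {x. c < HL_maximal g x}"
  then obtain r where r: "0 < r" and
    c: "c * emeasure lebesgue (ball x r) < (\<integral>\<^sup>+y\<in>ball x r. g y \<partial>lebesgue)"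
    by (auto simp: less_HL_maximal_iff)
  obtain s where s: "0 < s" "s < r"
    and cs: "c * emeasure lebesgue (ball x r) < (\<integral>\<^sup>+y\<in>ball x s. g y \<partial>lebesgue)"
    using set_nn_integral_ball_approximated_from_inside[OF g r c] by blast
  have "z \<in> {x. c < HL_maximal g x}" if "z \<in> ball x (r - s)" for z
  proof -
    have "ball x s \<subseteq> ball z r"
    proof
      fix y assume "y \<in> ball x s"
      then show "y \<in> ball z r" using that dist_triangle[of z y x] by (auto simp: dist_commute)
    qed
    then have "(\<integral>\<^sup>+y\<in>ball x s. g y \<partial>lebesgue) \<le> (\<integral>\<^sup>+y\<in>ball z r. g y \<partial>lebesgue)"
      by (intro nn_integral_mono) (auto split: split_indicator)
    moreover have "emeasure lebesgue (ball z r) = emeasure lebesgue (ball x r)"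
      using r by (simp only: emeasure_lebesgue_ball less_imp_le)
    ultimately show ?thesis using cs r by (auto simp: less_HL_maximal_iff intro!: exI[of _ r])
  qed
  then show "\<exists>e>0. ball x e \<subseteq> {x. c < HL_maximal g x}"
    using s by (intro exI[of _ "r - s"]) auto
qed

lemma borel_measurable_HL_maximal:
  fixes g :: "'a::euclidean_space \<Rightarrow> ennreal"
  assumes "g \<in> borel_measurable lebesgue"
  shows "HL_maximal g \<in> borel_measurable borel"
  using open_HL_maximal_greater[OF assms] by (intro borel_measurableI_greater) auto

text \<open>The counting step of Vitali's argument: disjoint balls each carrying \<open>m\<close>-mass at least \<open>c\<close> times
their volume cannot have large total volume, and enlarging them costs only the factor \<open>5^n\<close>.\<close>
lemma emeasure_UN_scaled_balls_le:
  fixes a :: "'i \<Rightarrow> 'a::euclidean_space"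
  assumes C: "countable C" and r: "\<And>i. i \<in> C \<Longrightarrow> 0 < r i"
    and disj: "pairwise (\<lambda>i j. disjnt (ball (a i) (r i)) (ball (a j) (r j))) C"
    and m: "sets m = sets lebesgue"
    and le: "\<And>i. i \<in> C \<Longrightarrow> c * emeasure lebesgue (ball (a i) (r i)) \<le> emeasure m (ball (a i) (r i))"
  shows "c * emeasure lebesgue (\<Union>i\<in>C. ball (a i) (5 * r i))
      \<le> 5 ^ DIM('a) * emeasure m UNIV"
proof -
  let ?N = "to_nat_on C ` C"
  define X where "X s n = (if n \<in> ?N then ball (a (from_nat_into C n)) (s * r (from_nat_into C n)) else {})" for s n
  have fn: "from_nat_into C n \<in> C" if "n \<in> ?N" for n
    using that C by auto
  have UN: "(\<Union>i\<in>C. ball (a i) (s * r i)) = (\<Union>n. X s n)" for s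
  proof (intro equalityI subsetI)
    fix x assume "x \<in> (\<Union>i\<in>C. ball (a i) (s * r i))"
    then obtain i where "i \<in> C" "x \<in> ball (a i) (s * r i)" by auto
    then have "x \<in> X s (to_nat_on C i)" using C by (auto simp: X_def)
    then show "x \<in> (\<Union>n. X s n)" by auto
  qed (use fn in \<open>force simp: X_def split: if_splits\<close>)
  have sets: "X s n \<in> sets lebesgue" for s n by (auto simp: X_def)
  have disjX: "disjoint_family (X 1)"
    unfolding disjoint_family_on_def
  proof (intro ballI impI)
    fix m n :: nat assume "m \<noteq> n"
    show "X 1 m \<inter> X 1 n = {}"
    proof (cases "m \<in> ?N \<and> n \<in> ?N")
      case True
      then have "from_nat_into C m \<noteq> from_nat_into C n"
        using \<open>m \<noteq> n\<close> C by (metis to_nat_on_from_nat_into)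
      then show ?thesis using True disj fn unfolding pairwise_def disjnt_def X_def by auto
    qed (auto simp: X_def)
  qed
  have vol: "c * emeasure lebesgue (X 5 n) \<le> 5 ^ DIM('a) * emeasure m (X 1 n)" for n
  proof (cases "n \<in> ?N")
    case True
    let ?i = "from_nat_into C n"
    have i: "?i \<in> C" using fn True by auto
    have "emeasure lebesgue (ball (a ?i) (5 * r ?i))
        = ennreal (5 ^ DIM('a) * (vol1 TYPE('a) * r ?i ^ DIM('a)))"
      using r[OF i] emeasure_lebesgue_ball[of "5 * r ?i" "a ?i"]
      by (simp only: power_mult_distrib mult.left_commute)
    also have "\<dots> = ennreal (5 ^ DIM('a)) * emeasure lebesgue (ball (a ?i) (r ?i))"
      using r[OF i] emeasure_lebesgue_ball[of "r ?i" "a ?i"] by (subst ennreal_mult) auto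
    also have "ennreal (5 ^ DIM('a)) = 5 ^ DIM('a)"
      by (metis ennreal_numeral ennreal_power zero_le_numeral)
    finally have "emeasure lebesgue (ball (a ?i) (5 * r ?i))
        = 5 ^ DIM('a) * emeasure lebesgue (ball (a ?i) (r ?i))" .
    then have "c * emeasure lebesgue (X 5 n) = 5 ^ DIM('a) * (c * emeasure lebesgue (ball (a ?i) (r ?i)))"
      using True by (simp add: X_def mult.left_commute)
    also have "\<dots> \<le> 5 ^ DIM('a) * emeasure m (X 1 n)"
      using le[OF i] True by (intro mult_left_mono) (auto simp: X_def)
    finally show ?thesis .
  qed (simp add: X_def)
  have "c * emeasure lebesgue (\<Union>i\<in>C. ball (a i) (5 * r i)) \<le> c * (\<Sum>n. emeasure lebesgue (X 5 n))"
    unfolding UN using sets by (intro mult_left_mono emeasure_subadditive_countably) auto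
  also have "\<dots> = (\<Sum>n. c * emeasure lebesgue (X 5 n))" by simp
  also have "\<dots> \<le> (\<Sum>n. 5 ^ DIM('a) * emeasure m (X 1 n))"
    by (intro suminf_le vol) auto
  also have "\<dots> = 5 ^ DIM('a) * (\<Sum>n. emeasure m (X 1 n))" by simp
  also have "\<dots> = 5 ^ DIM('a) * emeasure m (\<Union>n. X 1 n)"
    using sets m disjX by (subst suminf_emeasure) auto
  also have "\<dots> \<le> 5 ^ DIM('a) * emeasure m UNIV"
    using m by (intro mult_left_mono emeasure_mono) auto
  finally show ?thesis .
qed

text \<open>Every point of the superlevel set is the centre of a ball on which the average of \<open>g\<close> exceeds \<open>c\<close>.
When the total mass is finite, the radii of such balls are bounded, which is what the Vitali covering lemma
asks for.\<close>
lemma HL_maximal_weak_type: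
  fixes g :: "'a::euclidean_space \<Rightarrow> ennreal"
  assumes g: "g \<in> borel_measurable lebesgue" and c: "0 < c"
  shows "ennreal c * emeasure lebesgue {x. ennreal c < HL_maximal g x}
     \<le> 5 ^ DIM('a) * (\<integral>\<^sup>+x. g x \<partial>lebesgue)"
proof (cases "(\<integral>\<^sup>+x. g x \<partial>lebesgue) = \<infinity>")
  case True
  then show ?thesis by (simp add: ennreal_mult_top)
next
  case False
  then obtain G where G: "0 \<le> G" "(\<integral>\<^sup>+x. g x \<partial>lebesgue) = ennreal G"
    by (cases "\<integral>\<^sup>+x. g x \<partial>lebesgue") auto
  define m where "m = density lebesgue g"
  have m: "sets m = sets lebesgue" "emeasure m UNIV = ennreal G"
    using G g emeasure_density[of g lebesgue UNIV] by (auto simp: m_def)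
  have mball: "emeasure m (ball x r) = (\<integral>\<^sup>+y\<in>ball x r. g y \<partial>lebesgue)" for x r
    using emeasure_density[OF g, of "ball x r"] by (simp add: m_def)
  define K where "K = {(x, r). 0 < r \<and> ennreal c * emeasure lebesgue (ball x r) < emeasure m (ball x r)}"
  \<comment> \<open>For \<open>r \<ge> 1\<close> one has \<open>r \<le> r^n\<close>, and \<open>c * vol * r^n\<close> cannot exceed the total mass \<open>G\<close>.\<close>
  let ?T = "G / (c * vol1 TYPE('a))"
  have B: "0 < snd i \<and> snd i \<le> max 1 ?T" if "i \<in> K" for i
  proof -
    obtain x r where i: "i = (x, r)" by fastforce
    have r: "0 < r" and *: "ennreal c * emeasure lebesgue (ball x r) < emeasure m (ball x r)"
      using that i by (auto simp: K_def)
    have "emeasure m (ball x r) \<le> emeasure m UNIV" using m by (intro emeasure_mono) auto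
    with * m have "ennreal c * emeasure lebesgue (ball x r) \<le> ennreal G" by simp
    then have "ennreal (c * (vol1 TYPE('a) * r ^ DIM('a))) \<le> ennreal G"
      using r c emeasure_lebesgue_ball[of r x] by (subst ennreal_mult) auto
    then have "c * (vol1 TYPE('a) * r ^ DIM('a)) \<le> G" using G by simp
    then have "r ^ DIM('a) \<le> ?T" using c vol1_pos[where 'a='a] by (simp add: field_simps)
    moreover have "r \<le> r ^ DIM('a)" if "1 \<le> r" using that by (simp add: self_le_power)
    ultimately show ?thesis using r i by (cases "1 \<le> r") auto
  qed
  have cov: "{x. ennreal c < HL_maximal g x} \<subseteq> (\<Union>i\<in>K. ball (fst i) (snd i))"
  proof
    fix x assume "x \<in> {x. ennreal c < HL_maximal g x}"
    then obtain r where "0 < r" "ennreal c * emeasure lebesgue (ball x r) < emeasure m (ball x r)"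
      by (auto simp: less_HL_maximal_iff mball)
    then show "x \<in> (\<Union>i\<in>K. ball (fst i) (snd i))" by (intro UN_I[of "(x, r)"]) (auto simp: K_def)
  qed
  obtain C where C: "countable C" "C \<subseteq> K"
     "pairwise (\<lambda>i j. disjnt (ball (fst i) (snd i)) (ball (fst j) (snd j))) C"
     "{x. ennreal c < HL_maximal g x} \<subseteq> (\<Union>i\<in>C. ball (fst i) (5 * snd i))"
    by (rule Vitali_covering_lemma_balls[OF cov B])
  have "ennreal c * emeasure lebesgue {x. ennreal c < HL_maximal g x}
      \<le> ennreal c * emeasure lebesgue (\<Union>i\<in>C. ball (fst i) (5 * snd i))"
    using C by (intro mult_left_mono emeasure_mono) auto
  also have "\<dots> \<le> 5 ^ DIM('a) * emeasure m UNIV"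
  proof (rule emeasure_UN_scaled_balls_le[OF C(1) _ C(3) m(1)])
    fix i assume "i \<in> C"
    then have "i \<in> K" using C(2) by auto
    then show "0 < snd i" using B by auto
    show "ennreal c * emeasure lebesgue (ball (fst i) (snd i)) \<le> emeasure m (ball (fst i) (snd i))"
      using \<open>i \<in> K\<close> by (auto simp: K_def intro: less_imp_le)
  qed
  finally show ?thesis using m G by simp
qed

section \<open>The strong-type inequality for a constant exponent\<close>

lemma HL_maximal_le_truncation:
  fixes g :: "'a::euclidean_space \<Rightarrow> ennreal"
  assumes g: "g \<in> borel_measurable lebesgue"
  shows "HL_maximal g x \<le> c + HL_maximal (\<lambda>y. g y * indicator {y. c < g y} y) x"
  unfolding HL_maximal_le_iff[of g]
proof (intro allI impI)
  fix r :: real assume r: "0 < r"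
  define h where "h = (\<lambda>y. g y * indicator {y. c < g y} y)"
  have h[measurable]: "h \<in> borel_measurable lebesgue" using g unfolding h_def by measurable
  have [measurable]: "ball x r \<in> sets lebesgue" by simp
  have "(\<integral>\<^sup>+y\<in>ball x r. g y \<partial>lebesgue) \<le> (\<integral>\<^sup>+y. c * indicator (ball x r) y + h y * indicator (ball x r) y \<partial>lebesgue)"
    by (intro nn_integral_mono) (auto simp: h_def split: split_indicator)
  also have "\<dots> = c * emeasure lebesgue (ball x r) + (\<integral>\<^sup>+y\<in>ball x r. h y \<partial>lebesgue)"
    by (subst nn_integral_add) (measurable, simp only: nn_integral_cmult_indicator[OF \<open>ball x r \<in> sets lebesgue\<close>])
  also have "(\<integral>\<^sup>+y\<in>ball x r. h y \<partial>lebesgue) \<le> HL_maximal h x * emeasure lebesgue (ball x r)"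
    using HL_maximal_le_iff[of h x "HL_maximal h x"] r by blast
  finally show "(\<integral>\<^sup>+y\<in>ball x r. g y \<partial>lebesgue)
      \<le> (c + HL_maximal h x) * emeasure lebesgue (ball x r)"
    by (simp add: distrib_right add_left_mono)
qed

text \<open>Values of \<open>g\<close> below \<open>c\<close> contribute at most \<open>c\<close> to any average. This localised form of the weak-type
inequality is what makes interpolation with the trivial bound at infinity possible.\<close>
lemma HL_maximal_weak_type_truncated:
  fixes g :: "'a::euclidean_space \<Rightarrow> ennreal"
  assumes g: "g \<in> borel_measurable lebesgue" and c: "0 < c"
  shows "ennreal c * emeasure lebesgue {x. ennreal (2 * c) < HL_maximal g x}
     \<le> 5 ^ DIM('a) * (\<integral>\<^sup>+x. g x * indicator {x. ennreal c < g x} x \<partial>lebesgue)"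
proof -
  define h where "h = (\<lambda>y. g y * indicator {y. ennreal c < g y} y)"
  have h: "h \<in> borel_measurable lebesgue" using g unfolding h_def by measurable
  have "{x. ennreal (2 * c) < HL_maximal g x} \<subseteq> {x. ennreal c < HL_maximal h x}"
  proof
    fix x assume "x \<in> {x. ennreal (2 * c) < HL_maximal g x}"
    then have "ennreal c + ennreal c < HL_maximal g x" using c by (simp flip: ennreal_plus)
    also have "\<dots> \<le> ennreal c + HL_maximal h x"
      unfolding h_def by (rule HL_maximal_le_truncation[OF g])
    finally show "x \<in> {x. ennreal c < HL_maximal h x}"
      by (auto simp: ennreal_add_left_cancel_less)
  qed
  then have "ennreal c * emeasure lebesgue {x. ennreal (2 * c) < HL_maximal g x}
      \<le> ennreal c * emeasure lebesgue {x. ennreal c < HL_maximal h x}"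
    using open_HL_maximal_greater[OF h] by (intro mult_left_mono emeasure_mono) auto
  also have "\<dots> \<le> 5 ^ DIM('a) * (\<integral>\<^sup>+x. h x \<partial>lebesgue)"
    by (rule HL_maximal_weak_type[OF h c])
  finally show ?thesis by (simp add: h_def)
qed

text \<open>A discrete layer-cake bound from above. Starting at level 1 keeps the sum over natural numbers; the levels
below are absorbed in the constant, which is harmless on a set of finite measure.\<close>
lemma powr_le_dyadic_sum:
  fixes m s :: real
  assumes m: "0 \<le> m" and s: "1 < s"
  shows "ennreal ((1 + m) powr s)
    \<le> ennreal (2 powr s) + (\<Sum>k. ennreal ((2 powr s) ^ (k + 2)) * indicator {k. 2 ^ k < m} k)"
proof (cases "m \<le> 1")
  case True
  then have "(1 + m) powr s \<le> 2 powr s" using m s by (intro powr_mono2) auto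
  then have "ennreal ((1 + m) powr s) \<le> ennreal (2 powr s)" by (rule ennreal_leI)
  then show ?thesis by (meson add_increasing2 order_trans zero_le)
next
  case False
  define P where "P k \<longleftrightarrow> m \<le> 2 ^ k" for k :: nat
  obtain k0 where "P k0" using real_arch_pow[of 2 m] by (auto simp: P_def dest: less_imp_le)
  define k where "k = (LEAST k. P k)"
  have Pk: "P k" unfolding k_def using \<open>P k0\<close> by (rule LeastI)
  have "\<not> P 0" using False by (simp add: P_def)
  with Pk have "k \<noteq> 0" by metis
  then obtain j where j: "k = Suc j" by (cases k) auto
  have nP: "\<not> P j" using not_less_Least[of j P] j by (simp add: k_def[symmetric])
  have "(1 + m) powr s \<le> (2 ^ (j + 2)) powr s"
    using Pk False m s j by (intro powr_mono2) (auto simp: P_def)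
  also have "\<dots> = (2 powr s) ^ (j + 2)"
    by (simp only: powr_realpow[symmetric, of 2] powr_powr powr_power zero_less_numeral)
  finally have "ennreal ((1 + m) powr s) \<le> ennreal ((2 powr s) ^ (j + 2)) * indicator {k. 2 ^ k < m} j"
    using nP by (auto simp: P_def intro!: ennreal_leI)
  also have "\<dots> \<le> (\<Sum>k. ennreal ((2 powr s) ^ (k + 2)) * indicator {k. 2 ^ k < m} k)"
  proof -
    have "F j \<le> suminf F" for F :: "nat \<Rightarrow> ennreal"
      using sum_le_suminf[of F "{j}"] by auto
    then show ?thesis .
  qed
  finally show ?thesis by (meson add_increasing order_trans zero_le)
qed

text \<open>The converse discrete layer-cake bound: a geometric sum with ratio \<open>b > 1\<close> is comparable to its last
term, the one with \<open>2^k\<close> just below \<open>2 * u\<close>.\<close>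
lemma dyadic_sum_le_powr:
  fixes u s :: real
  assumes u: "0 \<le> u" and s: "1 < s"
  defines "b \<equiv> 2 powr (s - 1)"
  shows "(\<Sum>k. ennreal (b ^ k) * indicator {k. 2 ^ k < 2 * u} k)
    \<le> ennreal (b\<^sup>2 / (b - 1) * u powr (s - 1))"
proof -
  have b: "1 < b" unfolding b_def using s powr_less_mono[of 0 "s - 1" 2] by simp
  let ?X = "b\<^sup>2 / (b - 1) * u powr (s - 1)"
  have X0: "0 \<le> ?X" using b by simp
  have *: "(\<Sum>k<N. b ^ k * indicator {k. 2 ^ k < 2 * u} k) \<le> ?X" for N
  proof (induction N)
    case 0
    then show ?case using X0 by simp
  next
    case (Suc N)
    show ?case
    proof (cases "2 ^ N < 2 * u")
      case False
      then show ?thesis using Suc by simp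
    next
      case True
      have "(\<Sum>k<Suc N. b ^ k * indicator {k. 2 ^ k < 2 * u} k) \<le> (\<Sum>k<Suc N. b ^ k)"
        using b by (intro sum_mono) (auto split: split_indicator)
      also have "\<dots> \<le> b ^ Suc N / (b - 1)"
        using b by (subst geometric_sum) (auto intro!: divide_right_mono)
      also have "b ^ N = (2 ^ N) powr (s - 1)"
        by (simp add: b_def powr_powr powr_realpow[symmetric] mult.commute)
      then have "b ^ Suc N / (b - 1) = b / (b - 1) * (2 ^ N) powr (s - 1)" by simp
      also have "\<dots> \<le> b / (b - 1) * (2 * u) powr (s - 1)"
        using True s b by (intro mult_left_mono powr_mono2) auto
      also have "(2 * u) powr (s - 1) = b * u powr (s - 1)" using u by (simp add: powr_mult b_def)
      finally show ?thesis by (simp add: power2_eq_square)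
    qed
  qed
  have "(\<Sum>k<N. ennreal (b ^ k) * indicator {k. 2 ^ k < 2 * u} k) \<le> ennreal ?X" for N
  proof -
    have "(\<Sum>k<N. ennreal (b ^ k) * indicator {k. 2 ^ k < 2 * u} k)
        = (\<Sum>k<N. ennreal (b ^ k * indicator {k. 2 ^ k < 2 * u} k))"
      by (intro sum.cong) (auto split: split_indicator)
    also have "\<dots> = ennreal (\<Sum>k<N. b ^ k * indicator {k. 2 ^ k < 2 * u} k)"
      using b by (intro sum_ennreal) auto
    finally show ?thesis using * by (simp add: ennreal_leI)
  qed
  then show ?thesis by (intro suminf_le_const) auto
qed

definition strong_type_const :: "nat \<Rightarrow> real \<Rightarrow> real" where
  "strong_type_const n s =
     2 * 5 ^ n * (2 powr s) ^ 2 * ((2 powr (s - 1))\<^sup>2 / (2 powr (s - 1) - 1))"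

text \<open>Marcinkiewicz interpolation in dyadic form: layer-cake decomposition of the maximal function, the localised weak-type
inequality on each layer, and resummation of the layers under the integral.\<close>
lemma HL_maximal_strong_type:
  fixes u :: "'a::euclidean_space \<Rightarrow> real"
  assumes u[measurable]: "u \<in> borel_measurable lebesgue" and u0: "\<And>x. 0 \<le> u x" and s: "1 < s"
    and E[measurable]: "E \<in> sets lebesgue"
  shows "(\<integral>\<^sup>+x\<in>E. ennreal ((1 + enn2real (HL_maximal (\<lambda>y. ennreal (u y)) x)) powr s) \<partial>lebesgue)
    \<le> ennreal (2 powr s) * emeasure lebesgue E +
       ennreal (strong_type_const DIM('a) s) * (\<integral>\<^sup>+x. ennreal (u x powr s) \<partial>lebesgue)"
proof -
  define b where "b = 2 powr (s - 1)"
  define B where "B = 2 powr s"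
  have b: "1 < b" unfolding b_def using s powr_less_mono[of 0 "s - 1" 2] by simp
  have Bb: "B = 2 * b" by (simp add: B_def b_def powr_diff)
  have B: "0 < B" using Bb b by simp
  define M where "M = HL_maximal (\<lambda>y. ennreal (u y))"
  define S where "S k = {x. ennreal (2 ^ k) < M x}" for k :: nat
  have gm: "(\<lambda>y. ennreal (u y)) \<in> borel_measurable lebesgue" by measurable
  have S[measurable]: "S k \<in> sets lebesgue" for k
    using open_HL_maximal_greater[OF gm] by (auto simp: S_def M_def)
  define U where "U k = (\<integral>\<^sup>+x. ennreal (u x) * indicator {x. 2 ^ k < 2 * u x} x \<partial>lebesgue)" for k :: nat
  have weak: "ennreal (B ^ (k + 2)) * emeasure lebesgue (S k)
      \<le> ennreal (2 * 5 ^ DIM('a) * B\<^sup>2) * (ennreal (b ^ k) * U k)" for k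
  proof -
    have "ennreal (2 ^ k / 2) * emeasure lebesgue (S k)
        \<le> 5 ^ DIM('a) * (\<integral>\<^sup>+x. ennreal (u x) * indicator {x. ennreal (2 ^ k / 2) < ennreal (u x)} x \<partial>lebesgue)"
      using HL_maximal_weak_type_truncated[OF gm, of "2 ^ k / 2"] by (simp add: S_def M_def)
    also have "{x. ennreal (2 ^ k / 2) < ennreal (u x)} = {x. 2 ^ k < 2 * u x}"
      using u0 by (auto simp: ennreal_less_iff)
    finally have *: "ennreal (2 ^ k / 2) * emeasure lebesgue (S k) \<le> 5 ^ DIM('a) * U k" by (simp add: U_def)
    have "B ^ (k + 2) = (2 * B\<^sup>2 * b ^ k) * (2 ^ k / 2)"
      by (simp add: Bb power_add power_mult_distrib power2_eq_square)
    then have "ennreal (B ^ (k + 2)) * emeasure lebesgue (S k)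
        = ennreal (2 * B\<^sup>2 * b ^ k) * (ennreal (2 ^ k / 2) * emeasure lebesgue (S k))"
      using b by (simp only: mult.assoc[symmetric]) (subst ennreal_mult[symmetric], auto)
    also have "\<dots> \<le> ennreal (2 * B\<^sup>2 * b ^ k) * (5 ^ DIM('a) * U k)"
      by (intro mult_left_mono *) auto
    also have "(5::ennreal) ^ DIM('a) = ennreal (5 ^ DIM('a))"
      by (metis ennreal_numeral ennreal_power zero_le_numeral)
    also have "ennreal (2 * B\<^sup>2 * b ^ k) * (ennreal (5 ^ DIM('a)) * U k)
        = ennreal (2 * B\<^sup>2 * b ^ k * 5 ^ DIM('a)) * U k"
      using b by (simp add: ennreal_mult'' mult.assoc)
    also have "2 * B\<^sup>2 * b ^ k * 5 ^ DIM('a) = 2 * 5 ^ DIM('a) * B\<^sup>2 * b ^ k" by simp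
    also have "ennreal (2 * 5 ^ DIM('a) * B\<^sup>2 * b ^ k) * U k
        = ennreal (2 * 5 ^ DIM('a) * B\<^sup>2) * (ennreal (b ^ k) * U k)"
      using b by (simp add: ennreal_mult'' mult.assoc)
    finally show ?thesis .
  qed
  \<comment> \<open>The conversion \<open>enn2real\<close> sends an infinite value to 0, so it only shrinks the left-hand side.\<close>
  have "(\<integral>\<^sup>+x\<in>E. ennreal ((1 + enn2real (M x)) powr s) \<partial>lebesgue)
      \<le> (\<integral>\<^sup>+x. ennreal B * indicator E x + (\<Sum>k. ennreal (B ^ (k + 2)) * indicator (S k) x) \<partial>lebesgue)"
  proof (intro nn_integral_mono)
    fix x
    have "indicator {k. 2 ^ k < enn2real (M x)} k \<le> (indicator (S k) x :: ennreal)" for k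
    proof (cases "2 ^ k < enn2real (M x)")
      case True
      then have "ennreal (2 ^ k) < M x" by (cases "M x") (auto simp: ennreal_less_iff)
      then show ?thesis by (simp add: S_def split: split_indicator)
    qed simp
    then have "(\<Sum>k. ennreal (B ^ (k + 2)) * indicator {k. 2 ^ k < enn2real (M x)} k)
        \<le> (\<Sum>k. ennreal (B ^ (k + 2)) * indicator (S k) x)"
      by (intro suminf_le mult_left_mono) auto
    then have "ennreal ((1 + enn2real (M x)) powr s) \<le> ennreal B + (\<Sum>k. ennreal (B ^ (k + 2)) * indicator (S k) x)"
      using powr_le_dyadic_sum[of "enn2real (M x)" s] s unfolding B_def
      by (meson add_left_mono enn2real_nonneg order_trans)
    then show "ennreal ((1 + enn2real (M x)) powr s) * indicator E x
        \<le> ennreal B * indicator E x + (\<Sum>k. ennreal (B ^ (k + 2)) * indicator (S k) x)"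
      by (auto split: split_indicator)
  qed
  also have "\<dots> = ennreal B * emeasure lebesgue E + (\<Sum>k. ennreal (B ^ (k + 2)) * emeasure lebesgue (S k))"
    by (subst nn_integral_add) (auto simp: nn_integral_suminf nn_integral_cmult_indicator)
  also have "\<dots> \<le> ennreal B * emeasure lebesgue E +
      (\<Sum>k. ennreal (2 * 5 ^ DIM('a) * B\<^sup>2) * (ennreal (b ^ k) * U k))"
    by (intro add_left_mono suminf_le weak) auto
  also have "(\<Sum>k. ennreal (2 * 5 ^ DIM('a) * B\<^sup>2) * (ennreal (b ^ k) * U k))
      = ennreal (2 * 5 ^ DIM('a) * B\<^sup>2) * (\<Sum>k. ennreal (b ^ k) * U k)" by simp
  also have "(\<Sum>k. ennreal (b ^ k) * U k)
      = (\<integral>\<^sup>+x. (\<Sum>k. ennreal (b ^ k) * (ennreal (u x) * indicator {x. 2 ^ k < 2 * u x} x)) \<partial>lebesgue)"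
    unfolding U_def by (subst nn_integral_suminf) (auto simp: nn_integral_cmult)
  also have "\<dots> \<le> (\<integral>\<^sup>+x. ennreal (b\<^sup>2 / (b - 1)) * ennreal (u x powr s) \<partial>lebesgue)"
  proof (intro nn_integral_mono)
    fix x
    have "(\<Sum>k. ennreal (b ^ k) * (ennreal (u x) * indicator {x. 2 ^ k < 2 * u x} x))
        = (\<Sum>k. ennreal (u x) * (ennreal (b ^ k) * indicator {k. 2 ^ k < 2 * u x} k))"
      by (intro suminf_cong) (auto split: split_indicator simp: mult.commute)
    also have "\<dots> = ennreal (u x) * (\<Sum>k. ennreal (b ^ k) * indicator {k. 2 ^ k < 2 * u x} k)" by simp
    also have "\<dots> \<le> ennreal (u x) * ennreal (b\<^sup>2 / (b - 1) * u x powr (s - 1))"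
      unfolding b_def using dyadic_sum_le_powr[OF u0 s] by (intro mult_left_mono) auto
    also have "\<dots> = ennreal (b\<^sup>2 / (b - 1)) * ennreal (u x powr s)"
      using b u0[of x] by (simp add: ennreal_mult[symmetric] powr_diff mult_ac)
    finally show "(\<Sum>k. ennreal (b ^ k) * (ennreal (u x) * indicator {x. 2 ^ k < 2 * u x} x))
      \<le> ennreal (b\<^sup>2 / (b - 1)) * ennreal (u x powr s)" .
  qed
  also have "\<dots> = ennreal (b\<^sup>2 / (b - 1)) * (\<integral>\<^sup>+x. ennreal (u x powr s) \<partial>lebesgue)"
    by (rule nn_integral_cmult) measurable
  also have "ennreal (2 * 5 ^ DIM('a) * B\<^sup>2) * (ennreal (b\<^sup>2 / (b - 1)) * (\<integral>\<^sup>+x. ennreal (u x powr s) \<partial>lebesgue))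
      = ennreal (strong_type_const DIM('a) s) * (\<integral>\<^sup>+x. ennreal (u x powr s) \<partial>lebesgue)"
    unfolding strong_type_const_def B_def[symmetric] b_def[symmetric]
    using b by (simp only: mult.assoc[symmetric]) (subst ennreal_mult[symmetric], auto)
  finally show ?thesis by (simp add: B_def M_def add_left_mono mult_left_mono)
qed

section \<open>Log-Hoelder exponents on a bounded open set\<close>

lemma HL_maximal_finite_AE:
  fixes g :: "'a::euclidean_space \<Rightarrow> ennreal"
  assumes g: "g \<in> borel_measurable lebesgue" and fin: "(\<integral>\<^sup>+x. g x \<partial>lebesgue) < \<infinity>"
  shows "AE x in lebesgue. HL_maximal g x < \<infinity>"
proof -
  obtain G where G: "0 \<le> G" "5 ^ DIM('a) * (\<integral>\<^sup>+x. g x \<partial>lebesgue) = ennreal G"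
    using fin by (cases "5 ^ DIM('a) * (\<integral>\<^sup>+x. g x \<partial>lebesgue)")
      (auto simp: ennreal_mult_eq_top_iff power_eq_top_ennreal)
  let ?S = "{x. HL_maximal g x = \<infinity>}"
  have S: "?S \<in> sets lebesgue"
    using borel_measurable_HL_maximal[OF g] by (intro sets_completionI_sets) simp
  have le: "ennreal c * emeasure lebesgue ?S \<le> ennreal G" if c: "0 < c" for c
  proof -
    have "ennreal c * emeasure lebesgue ?S \<le> ennreal c * emeasure lebesgue {x. ennreal c < HL_maximal g x}"
      using open_HL_maximal_greater[OF g] by (intro mult_left_mono emeasure_mono) auto
    also have "\<dots> \<le> ennreal G" using HL_maximal_weak_type[OF g c] G by simp
    finally show ?thesis .
  qed
  have "emeasure lebesgue ?S = 0"
  proof (cases "emeasure lebesgue ?S")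
    case (real e)
    show ?thesis
    proof (rule ccontr)
      assume "emeasure lebesgue ?S \<noteq> 0"
      with real have e: "0 < e" by (cases "e = 0") auto
      have "ennreal ((G + 1) / e * e) \<le> ennreal G"
        using le[of "(G + 1) / e"] real e G by (subst ennreal_mult) auto
      then show False using e G by simp
    qed
  next
    case top
    then show ?thesis using le[of 1] by (simp add: top_unique)
  qed
  then have "?S \<in> null_sets lebesgue" using S by auto
  then show ?thesis by (rule AE_I') (auto simp: not_less top_unique)
qed

lemma borel_measurable_times_indicator_subset:
  fixes g :: "'a::euclidean_space \<Rightarrow> ennreal"
  assumes g: "g \<in> borel_measurable (lebesgue_on \<Omega>)"
    and \<Omega>: "\<Omega> \<in> sets lebesgue" and E: "E \<in> sets lebesgue" "E \<subseteq> \<Omega>"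
  shows "(\<lambda>x. g x * indicator E x) \<in> borel_measurable lebesgue"
proof -
  have "(\<lambda>x. g x * indicator \<Omega> x) \<in> borel_measurable lebesgue"
    using g \<Omega> by (simp add: borel_measurable_restrict_space_iff_ennreal)
  then have "(\<lambda>x. g x * indicator \<Omega> x * indicator E x) \<in> borel_measurable lebesgue"
    using E by measurable
  moreover have "(\<lambda>x. g x * indicator \<Omega> x * indicator E x) = (\<lambda>x. g x * indicator E x)"
    using E by (intro ext) (auto split: split_indicator)
  ultimately show ?thesis by simp
qed

text \<open>A substitute for both Jensen's and Hoelder's inequality: it bounds the first power of \<open>t\<close> by its
\<open>q\<close>-th power with a free threshold \<open>c\<close>, and since it is pointwise, \<open>q\<close> may vary from point to
point. Choosing \<open>c\<close> optimally loses only a constant factor.\<close>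
lemma le_add_powr_mult_powr:
  fixes t c q :: real
  assumes "0 \<le> t" "0 < c" "1 \<le> q"
  shows "t \<le> c + t powr q * c powr (1 - q)"
proof (cases "t \<le> c")
  case True
  then show ?thesis by (simp add: add_increasing2)
next
  case False
  then have "t = t powr q * t powr (1 - q)" using assms by (simp add: powr_add[symmetric])
  also have "\<dots> \<le> t powr q * c powr (1 - q)"
    using False assms by (intro mult_left_mono powr_mono2') auto
  finally show ?thesis using assms by simp
qed

lemma le_one_add_powr:
  fixes t q :: real
  assumes "0 \<le> t" "1 \<le> q"
  shows "t \<le> 1 + t powr q"
  using le_add_powr_mult_powr[of t 1 q] assms by simp

locale log_Hoelder_exponent =
  fixes \<Omega> :: "'a::euclidean_space set" and p :: "'a \<Rightarrow> real" and p\<^sub>m p\<^sub>M A :: real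
  assumes open_\<Omega>: "open \<Omega>" and bounded_\<Omega>: "bounded \<Omega>"
    and p_measurable: "p \<in> borel_measurable (lebesgue_on \<Omega>)"
    and pm_gt_1: "1 < p\<^sub>m"
    and pm_le: "x \<in> \<Omega> \<Longrightarrow> p\<^sub>m \<le> p x"
    and le_pM: "x \<in> \<Omega> \<Longrightarrow> p x \<le> p\<^sub>M"
    and A_pos: "0 < A"
    and log_Hoelder: "\<lbrakk>x \<in> \<Omega>; y \<in> \<Omega>; norm (x - y) \<le> 1/2\<rbrakk>
      \<Longrightarrow> \<bar>p x - p y\<bar> \<le> A / (- ln (norm (x - y)))"
begin

definition modular :: "'a set \<Rightarrow> ('a \<Rightarrow> real) \<Rightarrow> ennreal" where
  "modular E f = (\<integral>\<^sup>+x\<in>E. ennreal (\<bar>f x\<bar> powr p x) \<partial>lebesgue)"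

lemma \<Omega>_sets [measurable]: "\<Omega> \<in> sets lebesgue"
  using open_\<Omega> by auto

lemma emeasure_\<Omega>: "emeasure lebesgue \<Omega> = ennreal (measure lebesgue \<Omega>)"
  using bounded_set_imp_lmeasurable[OF bounded_\<Omega> \<Omega>_sets]
  by (intro emeasure_eq_ennreal_measure fmeasurableD2)

lemma one_less_p: "x \<in> \<Omega> \<Longrightarrow> 1 < p x"
  using pm_gt_1 pm_le by fastforce

lemma exponent_difference_le: "x \<in> \<Omega> \<Longrightarrow> y \<in> \<Omega> \<Longrightarrow> \<bar>p x - p y\<bar> \<le> p\<^sub>M"
  using le_pM[of x] le_pM[of y] one_less_p[of x] one_less_p[of y] by linarith

text \<open>The usable form of log-Hoelder continuity. The defining inequality covers \<open>\<rho> \<le> 1/2\<close>; for larger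
\<open>\<rho>\<close> both factors are bounded.\<close>
lemma exponent_difference_ln_bounded:
  obtains D where "0 \<le> D"
    "\<And>x y \<rho>. \<lbrakk>x \<in> \<Omega>; y \<in> \<Omega>; 0 < \<rho>; \<rho> \<le> R; norm (x - y) \<le> \<rho>\<rbrakk> \<Longrightarrow> \<bar>p x - p y\<bar> * \<bar>ln \<rho>\<bar> \<le> D"
proof
  let ?D = "A + \<bar>p\<^sub>M\<bar> * (ln 2 + \<bar>ln R\<bar>)"
  show "0 \<le> ?D" using A_pos by simp
  fix x y \<rho> assume *: "x \<in> \<Omega>" "y \<in> \<Omega>" "0 < \<rho>" "\<rho> \<le> R" "norm (x - y) \<le> \<rho>"
  show "\<bar>p x - p y\<bar> * \<bar>ln \<rho>\<bar> \<le> ?D"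
  proof (cases "\<rho> \<le> 1/2")
    case True
    have "\<bar>p x - p y\<bar> * \<bar>ln \<rho>\<bar> \<le> A"
    proof (cases "x = y")
      case False
      let ?d = "norm (x - y)"
      have d: "0 < ?d" "ln ?d \<le> ln \<rho>" "ln \<rho> < 0" using False * True by auto
      have "\<bar>p x - p y\<bar> * \<bar>ln \<rho>\<bar> \<le> A / (- ln ?d) * (- ln \<rho>)"
        using log_Hoelder[of x y] * True d by (intro mult_mono) auto
      also have "\<dots> = A * ((- ln \<rho>) / (- ln ?d))" by simp
      also have "(- ln \<rho>) / (- ln ?d) \<le> 1" using d * True by (subst divide_le_eq_1_pos) auto
      finally show ?thesis using A_pos by (simp add: mult_left_mono)
    qed (use A_pos in simp)
    then show ?thesis by (meson abs_ge_zero add_increasing2 add_nonneg_nonneg ln_ge_zero mult_nonneg_nonneg one_le_numeral)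
  next
    case False
    have "ln (1/2) \<le> ln \<rho>" using False * by (subst ln_le_cancel_iff) auto
    moreover have "ln \<rho> \<le> ln R" using * by (subst ln_le_cancel_iff) auto
    moreover have "ln (1/2) = - ln (2::real)" "0 \<le> ln (2::real)" by (auto simp: ln_div)
    ultimately have "\<bar>ln \<rho>\<bar> \<le> ln 2 + \<bar>ln R\<bar>" by linarith
    then have "\<bar>p x - p y\<bar> * \<bar>ln \<rho>\<bar> \<le> \<bar>p\<^sub>M\<bar> * (ln 2 + \<bar>ln R\<bar>)"
      using exponent_difference_le[of x y] * by (intro mult_mono) auto
    then show ?thesis using A_pos by simp
  qed
qed

lemma modular_integrand_measurable:
  assumes f: "f \<in> borel_measurable (lebesgue_on \<Omega>)" and E: "E \<in> sets lebesgue" "E \<subseteq> \<Omega>"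
  shows "(\<lambda>x. ennreal (\<bar>f x\<bar> powr p x) * indicator E x) \<in> borel_measurable lebesgue"
  using f p_measurable E by (intro borel_measurable_times_indicator_subset[OF _ \<Omega>_sets]) measurable

lemma set_nn_integral_abs_le_modular:
  assumes f: "f \<in> borel_measurable (lebesgue_on \<Omega>)" and E: "E \<in> sets lebesgue" "E \<subseteq> \<Omega>"
  shows "(\<integral>\<^sup>+x\<in>E. ennreal \<bar>f x\<bar> \<partial>lebesgue) \<le> emeasure lebesgue E + modular E f"
proof -
  note [measurable] = modular_integrand_measurable[OF f E]
  have "(\<integral>\<^sup>+x\<in>E. ennreal \<bar>f x\<bar> \<partial>lebesgue)
      \<le> (\<integral>\<^sup>+x. indicator E x + ennreal (\<bar>f x\<bar> powr p x) * indicator E x \<partial>lebesgue)"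
  proof (intro nn_integral_mono)
    fix x
    show "ennreal \<bar>f x\<bar> * indicator E x \<le> indicator E x + ennreal (\<bar>f x\<bar> powr p x) * indicator E x"
    proof (cases "x \<in> E")
      case True
      then have "\<bar>f x\<bar> \<le> 1 + \<bar>f x\<bar> powr p x"
        using E one_less_p[of x] by (intro le_one_add_powr) auto
      then have "ennreal \<bar>f x\<bar> \<le> ennreal (1 + \<bar>f x\<bar> powr p x)" by (rule ennreal_leI)
      then show ?thesis using True by (simp add: ennreal_plus)
    qed simp
  qed
  also have "\<dots> = emeasure lebesgue E + modular E f"
    unfolding modular_def using E by (subst nn_integral_add) auto
  finally show ?thesis .
qed

text \<open>The function whose \<open>p\<^sub>m\<close>-th power integrates to the modular of \<open>f\<close>; it is extended by zero so that
its averages are taken over full balls.\<close>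
definition averaged_power :: "('a \<Rightarrow> real) \<Rightarrow> 'a \<Rightarrow> real" where
  "averaged_power f y = (if y \<in> \<Omega> then \<bar>f y\<bar> powr (p y / p\<^sub>m) else 0)"

lemma averaged_power_nonneg: "0 \<le> averaged_power f y"
  by (simp add: averaged_power_def)

lemma averaged_power_measurable:
  assumes f: "f \<in> borel_measurable (lebesgue_on \<Omega>)"
  shows "averaged_power f \<in> borel_measurable lebesgue"
proof -
  have "(\<lambda>y. \<bar>f y\<bar> powr (p y / p\<^sub>m)) \<in> borel_measurable (lebesgue_on \<Omega>)"
    using f p_measurable by measurable
  from borel_measurable_if_I[OF this \<Omega>_sets] show ?thesis
    unfolding averaged_power_def by simp
qed

lemma nn_integral_averaged_power_powr:
  "(\<integral>\<^sup>+y. ennreal (averaged_power f y powr p\<^sub>m) \<partial>lebesgue) = modular \<Omega> f"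
  unfolding modular_def averaged_power_def using pm_gt_1
  by (intro nn_integral_cong) (auto simp: powr_powr split: split_indicator)

lemma nn_integral_averaged_power_le:
  assumes f: "f \<in> borel_measurable (lebesgue_on \<Omega>)" and mod: "modular \<Omega> f \<le> 1"
  shows "(\<integral>\<^sup>+y. ennreal (averaged_power f y) \<partial>lebesgue) \<le> ennreal (measure lebesgue \<Omega> + 1)"
proof -
  note [measurable] = modular_integrand_measurable[OF f \<Omega>_sets order_refl]
  have "(\<integral>\<^sup>+y. ennreal (averaged_power f y) \<partial>lebesgue)
     \<le> (\<integral>\<^sup>+y. indicator \<Omega> y + ennreal (\<bar>f y\<bar> powr p y) * indicator \<Omega> y \<partial>lebesgue)"
  proof (intro nn_integral_mono)
    fix y
    have "averaged_power f y \<le> 1 + \<bar>f y\<bar> powr p y" if "y \<in> \<Omega>"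
      using le_one_add_powr[of "averaged_power f y" "p\<^sub>m"] pm_gt_1 that
      by (simp add: averaged_power_def powr_powr)
    then have "ennreal (averaged_power f y) \<le> ennreal (1 + \<bar>f y\<bar> powr p y)" if "y \<in> \<Omega>"
      using that by (intro ennreal_leI)
    then show "ennreal (averaged_power f y) \<le> indicator \<Omega> y + ennreal (\<bar>f y\<bar> powr p y) * indicator \<Omega> y"
      by (cases "y \<in> \<Omega>") (auto simp: averaged_power_def ennreal_plus)
  qed
  also have "\<dots> = emeasure lebesgue \<Omega> + modular \<Omega> f"
    unfolding modular_def by (subst nn_integral_add) auto
  also have "\<dots> \<le> ennreal (measure lebesgue \<Omega>) + 1" using mod emeasure_\<Omega> by (intro add_mono) auto
  finally show ?thesis by (simp add: ennreal_plus)
qed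

section \<open>Boundedness of the maximal operator on the variable exponent space\<close>

text \<open>On a ball of radius \<open>r\<close> let \<open>K\<close> be 1 plus the average of \<open>u = averaged_power f\<close>, and split \<open>f\<close> at height
\<open>K powr (p\<^sub>m / p x)\<close>. Passing from the exponent at \<open>y\<close> to the one at the centre \<open>x\<close> costs a power of
\<open>K\<close> with exponent of the order of \<open>p x - p y\<close>. Since the integral of \<open>u\<close> is bounded, \<open>K\<close> grows for
small \<open>r\<close> at most like \<open>r powr (-n)\<close>, so log-Hoelder continuity bounds this cost.\<close>
lemma maximal_op_pointwise_bound:
  obtains D where "1 \<le> D"
    "\<And>f x. \<lbrakk>f \<in> borel_measurable (lebesgue_on \<Omega>); modular \<Omega> f \<le> 1; x \<in> \<Omega>;
        HL_maximal (\<lambda>y. ennreal (averaged_power f y)) x < \<infinity>\<rbrakk>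
     \<Longrightarrow> maximal_op \<Omega> f x
        \<le> ennreal (D * (1 + enn2real (HL_maximal (\<lambda>y. ennreal (averaged_power f y)) x)) powr (p\<^sub>m / p x))"
proof -
  define R where "R = diameter \<Omega> + 1"
  define v where "v = vol1 TYPE('a)"
  define W where "W = measure lebesgue \<Omega> + 1"
  define n where "n = real DIM('a)"
  have R: "1 \<le> R" unfolding R_def using diameter_ge_0[OF bounded_\<Omega>] by simp
  have v: "0 < v" unfolding v_def by (rule vol1_pos)
  have W: "1 \<le> W" by (simp add: W_def)
  obtain D0 where D0: "0 \<le> D0"
    "\<And>x y \<rho>. \<lbrakk>x \<in> \<Omega>; y \<in> \<Omega>; 0 < \<rho>; \<rho> \<le> R; norm (x - y) \<le> \<rho>\<rbrakk> \<Longrightarrow> \<bar>p x - p y\<bar> * \<bar>ln \<rho>\<bar> \<le> D0"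
    by (rule exponent_difference_ln_bounded[of R]) (blast intro: that)
  define c where "c = W / v + R powr n"
  have c: "1 \<le> c" using R v W unfolding c_def n_def by (intro add_increasing) (auto intro: ge_one_powr_ge_zero)
  define D where "D = c powr \<bar>p\<^sub>M\<bar> * exp (n * D0)"
  have D: "1 \<le> D" using ge_one_powr_ge_zero[OF c, of "\<bar>p\<^sub>M\<bar>"] D0 mult_mono[of 1 "c powr \<bar>p\<^sub>M\<bar>" 1 "exp (n * D0)"]
    by (simp add: D_def n_def)
  show thesis
  proof (rule that[of "1 + D"])
    show "1 \<le> 1 + D" using D by simp
    fix f x
    assume f: "f \<in> borel_measurable (lebesgue_on \<Omega>)" and mod: "modular \<Omega> f \<le> 1" and x: "x \<in> \<Omega>"
      and fin: "HL_maximal (\<lambda>y. ennreal (averaged_power f y)) x < \<infinity>"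
    define u where "u = averaged_power f"
    have u_meas[measurable]: "u \<in> borel_measurable lebesgue"
      unfolding u_def by (rule averaged_power_measurable[OF f])
    have u0: "0 \<le> u y" for y by (simp add: u_def averaged_power_nonneg)
    define m where "m = enn2real (HL_maximal (\<lambda>y. ennreal (u y)) x)"
    have m: "HL_maximal (\<lambda>y. ennreal (u y)) x = ennreal m" "0 \<le> m"
      using fin by (auto simp: m_def u_def less_top)
    have px: "1 < p x" using one_less_p x by simp
    show "maximal_op \<Omega> f x
        \<le> ennreal ((1 + D) * (1 + enn2real (HL_maximal (\<lambda>y. ennreal (averaged_power f y)) x)) powr (p\<^sub>m / p x))"
      unfolding u_def[symmetric] m_def[symmetric] maximal_op_eq_HL_maximal HL_maximal_le_iff
    proof (intro allI impI)
      fix r :: real assume r: "0 < r"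
      let ?B = "ball x r"
      have [measurable]: "?B \<in> sets lebesgue" by simp
      define V where "V = v * r ^ DIM('a)"
      have V: "0 < V" "emeasure lebesgue ?B = ennreal V"
        using r v by (auto simp: V_def v_def emeasure_ball)
      \<comment> \<open>Two points of \<open>\<Omega>\<close> are never further apart than \<open>R\<close>, so truncating the radius at \<open>R\<close>
        treats small and large balls alike.\<close>
      define \<rho> where "\<rho> = min r R"
      have \<rho>: "0 < \<rho>" "\<rho> \<le> R" "\<rho> \<le> r" using r R by (auto simp: \<rho>_def)
      have near: "norm (x - y) \<le> \<rho>" if "y \<in> ?B" "y \<in> \<Omega>" for y
        using that x diameter_bounded_bound[OF bounded_\<Omega>, of x y]
        by (auto simp: \<rho>_def R_def dist_norm)
      have "(\<integral>\<^sup>+y\<in>?B. ennreal (u y) \<partial>lebesgue) \<le> (\<integral>\<^sup>+y. ennreal (u y) \<partial>lebesgue)"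
        by (intro nn_integral_mono) (auto split: split_indicator)
      also have "\<dots> \<le> ennreal W"
        unfolding u_def W_def by (rule nn_integral_averaged_power_le[OF f mod])
      finally have GW: "(\<integral>\<^sup>+y\<in>?B. ennreal (u y) \<partial>lebesgue) \<le> ennreal W" .
      define G where "G = enn2real (\<integral>\<^sup>+y\<in>?B. ennreal (u y) \<partial>lebesgue)"
      have G: "(\<integral>\<^sup>+y\<in>?B. ennreal (u y) \<partial>lebesgue) = ennreal G" "0 \<le> G"
        using le_less_trans[OF GW ennreal_less_top] by (simp_all add: G_def)
      have "G \<le> W" using GW G W by simp
      have "ennreal G \<le> ennreal m * ennreal V"
        using HL_maximal_le_iff[of "\<lambda>y. ennreal (u y)" x "ennreal m"] m r G V by auto
      then have "G \<le> m * V" using m V by (simp flip: ennreal_mult)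
      define K where "K = G / V + 1"
      have K: "1 \<le> K" "K \<le> 1 + m" "G / K \<le> V"
        using G V m \<open>G \<le> m * V\<close> by (auto simp: K_def field_simps)
      have "K \<le> c * \<rho> powr (- n)"
      proof -
        have rn: "\<rho> powr n = \<rho> ^ DIM('a)" using \<rho> by (simp add: n_def powr_realpow)
        have "v * \<rho> powr n \<le> V" unfolding rn V_def using \<rho> v by (intro mult_left_mono power_mono) auto
        then have "G / V \<le> W / (v * \<rho> powr n)"
          using \<open>G \<le> W\<close> v \<rho> G by (intro frac_le) auto
        moreover have "1 \<le> R powr n * \<rho> powr (- n)"
          using \<rho> R powr_mono2[of n \<rho> R] by (simp add: n_def powr_minus field_simps)
        moreover have "c * \<rho> powr (- n) = W / (v * \<rho> powr n) + R powr n * \<rho> powr (- n)"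
          by (simp add: c_def powr_minus distrib_right divide_inverse mult.assoc)
        ultimately show ?thesis unfolding K_def by linarith
      qed
      have osc: "K powr ((p x - p y) / p x) \<le> D" if y: "y \<in> ?B" "y \<in> \<Omega>" for y
      proof -
        let ?e = "\<bar>p x - p y\<bar>"
        have "(p x - p y) / p x \<le> ?e / 1" using px by (intro frac_le) auto
        then have "K powr ((p x - p y) / p x) \<le> K powr ?e" using K by (intro powr_mono) auto
        also have "\<dots> \<le> (c * \<rho> powr (- n)) powr ?e"
          using \<open>K \<le> c * \<rho> powr (- n)\<close> K by (intro powr_mono2) auto
        also have "\<dots> = c powr ?e * exp (- n * (?e * ln \<rho>))"
          using c \<rho> by (simp add: powr_mult powr_powr) (simp add: powr_def mult_ac)
        also have "\<dots> \<le> c powr \<bar>p\<^sub>M\<bar> * exp (n * D0)"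
        proof (intro mult_mono)
          show "c powr ?e \<le> c powr \<bar>p\<^sub>M\<bar>"
            using c exponent_difference_le[OF x y(2)] by (intro powr_mono) auto
          have "- (?e * ln \<rho>) \<le> ?e * \<bar>ln \<rho>\<bar>"
            by (metis abs_ge_minus_self abs_ge_zero mult_left_mono mult_minus_right)
          also have "\<dots> \<le> D0" using D0(2)[OF x y(2) \<rho>(1,2) near[OF y]] .
          finally have "n * (- (?e * ln \<rho>)) \<le> n * D0" by (intro mult_left_mono) (auto simp: n_def)
          then show "exp (- n * (?e * ln \<rho>)) \<le> exp (n * D0)" by simp
        qed auto
        finally show ?thesis by (simp add: D_def)
      qed
      define h where "h = K powr (p\<^sub>m / p x)"
      have h: "0 < h" using K by (simp add: h_def)
      have pt: "\<bar>f y\<bar> \<le> h + h * D / K * u y" if y: "y \<in> ?B" "y \<in> \<Omega>" for y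
      proof -
        let ?q = "p y / p\<^sub>m"
        have uy: "u y = \<bar>f y\<bar> powr ?q" using y by (simp add: u_def averaged_power_def)
        have "p\<^sub>m / p x * (1 - ?q) = p\<^sub>m / p x + (- 1 + (p x - p y) / p x)"
          using px pm_gt_1 by (simp add: field_simps)
        then have "h powr (1 - ?q) = h * (K powr (- 1) * K powr ((p x - p y) / p x))"
          by (simp only: h_def powr_powr powr_add)
        also have "\<dots> \<le> h * (K powr (- 1) * D)"
          using osc[OF y] h by (intro mult_left_mono) auto
        also have "\<dots> = h * D / K" using K by (simp add: powr_minus field_simps)
        finally have hq: "h powr (1 - ?q) \<le> h * D / K" .
        have "\<bar>f y\<bar> \<le> h + \<bar>f y\<bar> powr ?q * h powr (1 - ?q)"
          using h pm_gt_1 pm_le[OF y(2)] by (intro le_add_powr_mult_powr) auto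
        also have "\<dots> \<le> h + \<bar>f y\<bar> powr ?q * (h * D / K)"
          using hq by (intro add_left_mono mult_left_mono) auto
        finally show ?thesis by (simp add: uy mult.commute)
      qed
      have hDK: "0 \<le> h * D / K" using h D K by simp
      have "(\<integral>\<^sup>+y\<in>?B. ennreal \<bar>f y\<bar> * indicator \<Omega> y \<partial>lebesgue)
          \<le> (\<integral>\<^sup>+y. ennreal h * indicator ?B y + ennreal (h * D / K) * (ennreal (u y) * indicator ?B y) \<partial>lebesgue)"
      proof (intro nn_integral_mono)
        fix y
        show "ennreal \<bar>f y\<bar> * indicator \<Omega> y * indicator ?B y
          \<le> ennreal h * indicator ?B y + ennreal (h * D / K) * (ennreal (u y) * indicator ?B y)"
        proof (cases "y \<in> ?B \<and> y \<in> \<Omega>")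
          case True
          then have "ennreal \<bar>f y\<bar> \<le> ennreal (h + h * D / K * u y)" by (intro ennreal_leI pt) auto
          also have "\<dots> = ennreal h + ennreal (h * D / K) * ennreal (u y)"
            using h hDK u0[of y] by (simp only: ennreal_plus ennreal_mult mult_nonneg_nonneg less_imp_le)
          finally show ?thesis using True by simp
        qed (auto split: split_indicator)
      qed
      also have "\<dots> = ennreal h * ennreal V + ennreal (h * D / K) * ennreal G"
        unfolding V(2)[symmetric] G(1)[symmetric]
        by (subst nn_integral_add) (measurable, simp add: nn_integral_cmult nn_integral_cmult_indicator)
      also have "\<dots> = ennreal (h * V + h * D / K * G)"
        using h hDK V G by (simp only: ennreal_plus ennreal_mult mult_nonneg_nonneg less_imp_le)
      also have "\<dots> \<le> ennreal ((1 + D) * (1 + m) powr (p\<^sub>m / p x) * V)"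
      proof (rule ennreal_leI)
        have "h * V + h * D / K * G = h * V + h * D * (G / K)" by simp
        also have "\<dots> \<le> h * V + h * D * V" using h D K by (intro add_left_mono mult_left_mono) auto
        also have "\<dots> = (1 + D) * h * V" by (simp add: algebra_simps)
        also have "\<dots> \<le> (1 + D) * (1 + m) powr (p\<^sub>m / p x) * V"
          unfolding h_def using K V D px pm_gt_1
          by (intro mult_right_mono mult_left_mono powr_mono2) auto
        finally show "h * V + h * D / K * G \<le> (1 + D) * (1 + m) powr (p\<^sub>m / p x) * V" .
      qed
      also have "\<dots> = ennreal ((1 + D) * (1 + m) powr (p\<^sub>m / p x)) * emeasure lebesgue ?B"
        unfolding V(2) using V D by (subst ennreal_mult) auto
      finally show "(\<integral>\<^sup>+y\<in>?B. ennreal \<bar>f y\<bar> * indicator \<Omega> y \<partial>lebesgue)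
        \<le> ennreal ((1 + D) * (1 + m) powr (p\<^sub>m / p x)) * emeasure lebesgue ?B" .
    qed
  qed
qed

text \<open>Raised to the power \<open>p x\<close>, the pointwise bound has a constant exponent \<open>p\<^sub>m > 1\<close> on its right-hand side.
The constant can be moved into the argument of the modular because \<open>p \<ge> 1\<close> and the scaling factor is at
most 1.\<close>
lemma maximal_op_modular_bound:
  obtains K where "1 \<le> K"
    "\<And>f. \<lbrakk>f \<in> borel_measurable (lebesgue_on \<Omega>); modular \<Omega> f \<le> 1\<rbrakk>
     \<Longrightarrow> modular \<Omega> (\<lambda>x. enn2real (maximal_op \<Omega> f x) / K) \<le> 1"
proof -
  obtain D where D: "1 \<le> D"
    "\<And>f x. \<lbrakk>f \<in> borel_measurable (lebesgue_on \<Omega>); modular \<Omega> f \<le> 1; x \<in> \<Omega>;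
        HL_maximal (\<lambda>y. ennreal (averaged_power f y)) x < \<infinity>\<rbrakk>
     \<Longrightarrow> maximal_op \<Omega> f x
        \<le> ennreal (D * (1 + enn2real (HL_maximal (\<lambda>y. ennreal (averaged_power f y)) x)) powr (p\<^sub>m / p x))"
    by (rule maximal_op_pointwise_bound) (blast intro: that)
  define S where "S = strong_type_const DIM('a) p\<^sub>m"
  have S: "0 \<le> S" unfolding S_def strong_type_const_def
    using pm_gt_1 by (auto intro!: divide_nonneg_nonneg ge_one_powr_ge_zero)
  define K1 where "K1 = 2 powr p\<^sub>m * measure lebesgue \<Omega> + S"
  define K where "K = D * (1 + K1)"
  have K1: "0 \<le> K1" using S by (simp add: K1_def)
  have K: "1 \<le> K" using D K1 mult_mono[of 1 D 1 "1 + K1"] by (simp add: K_def)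
  show thesis
  proof (rule that[OF K])
    fix f assume f: "f \<in> borel_measurable (lebesgue_on \<Omega>)" and mod: "modular \<Omega> f \<le> 1"
    define u where "u = averaged_power f"
    have u[measurable]: "u \<in> borel_measurable lebesgue"
      unfolding u_def by (rule averaged_power_measurable[OF f])
    have u0: "0 \<le> u y" for y by (simp add: u_def averaged_power_nonneg)
    define m where "m x = enn2real (HL_maximal (\<lambda>y. ennreal (u y)) x)" for x
    have [measurable]: "HL_maximal (\<lambda>y. ennreal (u y)) \<in> borel_measurable borel"
      by (rule borel_measurable_HL_maximal) measurable
    have m_meas: "m \<in> borel_measurable borel" unfolding m_def by measurable
    then have [measurable]: "m \<in> borel_measurable lebesgue" by (intro measurable_completion) simp
    have "AE x in lebesgue. HL_maximal (\<lambda>y. ennreal (u y)) x < \<infinity>"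
    proof (rule HL_maximal_finite_AE)
      show "(\<integral>\<^sup>+y. ennreal (u y) \<partial>lebesgue) < \<infinity>"
        unfolding u_def infinity_ennreal_def
        by (rule le_less_trans[OF nn_integral_averaged_power_le[OF f mod] ennreal_less_top])
    qed measurable
    then have ae: "AE x in lebesgue.
        ennreal (\<bar>enn2real (maximal_op \<Omega> f x) / K\<bar> powr p x) * indicator \<Omega> x
        \<le> ennreal (1 / (1 + K1)) * (ennreal ((1 + m x) powr p\<^sub>m) * indicator \<Omega> x)"
    proof eventually_elim
      fix x assume fin: "HL_maximal (\<lambda>y. ennreal (u y)) x < \<infinity>"
      show "ennreal (\<bar>enn2real (maximal_op \<Omega> f x) / K\<bar> powr p x) * indicator \<Omega> x
        \<le> ennreal (1 / (1 + K1)) * (ennreal ((1 + m x) powr p\<^sub>m) * indicator \<Omega> x)"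
      proof (cases "x \<in> \<Omega>")
        case True
        let ?M = "maximal_op \<Omega> f x"
        let ?h = "(1 + m x) powr (p\<^sub>m / p x)"
        have px: "1 < p x" using one_less_p True by simp
        have m0: "0 \<le> m x" by (simp add: m_def)
        have "?M \<le> ennreal (D * ?h)"
          using D(2)[OF f mod True] fin by (simp add: u_def m_def)
        then have "enn2real ?M \<le> D * ?h"
          using D by (intro enn2real_leI) auto
        then have "enn2real ?M / K \<le> D * ?h / K"
          using K by (intro divide_right_mono) auto
        also have "\<dots> = ?h * (1 / (1 + K1))" using D K1 by (simp add: K_def)
        finally have "\<bar>enn2real ?M / K\<bar> \<le> ?h * (1 / (1 + K1))" using K by simp
        then have "\<bar>enn2real ?M / K\<bar> powr p x \<le> (?h * (1 / (1 + K1))) powr p x"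
          using px by (intro powr_mono2) auto
        also have "\<dots> = (1 + m x) powr p\<^sub>m * (1 / (1 + K1)) powr p x"
          using px m0 K1 by (subst powr_mult) (auto simp: powr_powr)
        also have "\<dots> \<le> (1 + m x) powr p\<^sub>m * (1 / (1 + K1)) powr 1"
          using px K1 by (intro mult_left_mono powr_mono') auto
        finally have "\<bar>enn2real ?M / K\<bar> powr p x \<le> 1 / (1 + K1) * (1 + m x) powr p\<^sub>m"
          using K1 by simp
        then have "ennreal (\<bar>enn2real ?M / K\<bar> powr p x) \<le> ennreal (1 / (1 + K1)) * ennreal ((1 + m x) powr p\<^sub>m)"
          using K1 by (subst ennreal_mult[symmetric]) (auto intro: ennreal_leI)
        then show ?thesis using True by simp
      qed simp
    qed
    have "modular \<Omega> (\<lambda>x. enn2real (maximal_op \<Omega> f x) / K)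
      \<le> (\<integral>\<^sup>+x. ennreal (1 / (1 + K1)) * (ennreal ((1 + m x) powr p\<^sub>m) * indicator \<Omega> x) \<partial>lebesgue)"
      unfolding modular_def by (rule nn_integral_mono_AE[OF ae])
    also have "\<dots> = ennreal (1 / (1 + K1)) * (\<integral>\<^sup>+x\<in>\<Omega>. ennreal ((1 + m x) powr p\<^sub>m) \<partial>lebesgue)"
      by (rule nn_integral_cmult) measurable
    also have "\<dots> \<le> ennreal (1 / (1 + K1)) * ennreal K1"
    proof (rule mult_left_mono)
      have "(\<integral>\<^sup>+x\<in>\<Omega>. ennreal ((1 + m x) powr p\<^sub>m) \<partial>lebesgue)
        \<le> ennreal (2 powr p\<^sub>m) * emeasure lebesgue \<Omega> + ennreal S * (\<integral>\<^sup>+x. ennreal (u x powr p\<^sub>m) \<partial>lebesgue)"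
        unfolding m_def S_def by (rule HL_maximal_strong_type[OF u u0 pm_gt_1 \<Omega>_sets])
      also have "\<dots> \<le> ennreal (2 powr p\<^sub>m) * ennreal (measure lebesgue \<Omega>) + ennreal S * 1"
        unfolding u_def nn_integral_averaged_power_powr emeasure_\<Omega>
        using mod by (intro add_left_mono mult_left_mono) auto
      also have "\<dots> = ennreal K1"
        using S by (simp add: K1_def ennreal_mult)
      finally show "(\<integral>\<^sup>+x\<in>\<Omega>. ennreal ((1 + m x) powr p\<^sub>m) \<partial>lebesgue) \<le> ennreal K1" .
    qed simp
    also have "\<dots> = ennreal (K1 / (1 + K1))" using K1 by (simp flip: ennreal_mult)
    also have "\<dots> \<le> 1" using K1 by simp
    finally show "modular \<Omega> (\<lambda>x. enn2real (maximal_op \<Omega> f x) / K) \<le> 1" .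
  qed
qed

end

section \<open>Redistributing the mass near a point\<close>

text \<open>A ball centred at \<open>x\<close> either misses \<open>ball x0 s\<close>, or has radius larger than \<open>s\<close>, and then its
threefold enlargement contains \<open>ball x0 s\<close>, so only the mass on \<open>ball x0 s\<close> matters.\<close>
lemma HL_maximal_le_redistribution:
  fixes f h :: "'a::euclidean_space \<Rightarrow> ennreal"
  assumes f[measurable]: "f \<in> borel_measurable lebesgue" and h[measurable]: "h \<in> borel_measurable lebesgue"
    and far: "\<And>y. y \<notin> ball x0 s \<Longrightarrow> f y \<le> h y"
    and near: "(\<integral>\<^sup>+y\<in>ball x0 s. f y \<partial>lebesgue) \<le> (\<integral>\<^sup>+y\<in>ball x0 s. h y \<partial>lebesgue)"
    and x: "2 * s \<le> dist x0 x"
  shows "HL_maximal f x \<le> 3 ^ DIM('a) * HL_maximal h x"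
  unfolding HL_maximal_le_iff
proof (intro allI impI)
  fix r :: real assume r: "0 < r"
  let ?Q = "ball x0 s"
  have [measurable]: "ball y \<rho> \<in> sets lebesgue" for y :: 'a and \<rho> by simp
  have three: "(3::ennreal) ^ DIM('a) = ennreal (3 ^ DIM('a))"
    by (metis ennreal_numeral ennreal_power zero_le_numeral)
  have avg: "(\<integral>\<^sup>+y\<in>ball x \<rho>. h y \<partial>lebesgue) \<le> HL_maximal h x * emeasure lebesgue (ball x \<rho>)" if "0 < \<rho>" for \<rho>
    using HL_maximal_le_iff[of h x "HL_maximal h x"] that by blast
  have ball3: "emeasure lebesgue (ball x (3 * r)) = 3 ^ DIM('a) * emeasure lebesgue (ball x r)"
  proof -
    have "emeasure lebesgue (ball x (3 * r)) = ennreal (3 ^ DIM('a) * (vol1 TYPE('a) * r ^ DIM('a)))"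
      using r emeasure_lebesgue_ball[of "3 * r" x] by (simp only: power_mult_distrib mult.left_commute)
    also have "\<dots> = ennreal (3 ^ DIM('a)) * emeasure lebesgue (ball x r)"
      using r emeasure_lebesgue_ball[of r x] by (subst ennreal_mult) auto
    finally show ?thesis by (simp only: three)
  qed
  have "(\<integral>\<^sup>+y\<in>ball x r. f y \<partial>lebesgue) \<le> (\<integral>\<^sup>+y\<in>ball x (3 * r). h y \<partial>lebesgue)"
  proof (cases "ball x r \<inter> ?Q = {}")
    case True
    have "f y * indicator (ball x r) y \<le> h y * indicator (ball x (3 * r)) y" for y
      using far[of y] True r by (cases "y \<in> ball x r") (auto simp: disjoint_iff)
    then show ?thesis by (intro nn_integral_mono) auto
  next
    case False
    then obtain z where z: "dist x z < r" "dist x0 z < s" by auto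
    then have s: "s < r" using x dist_triangle[of x0 x z] by (simp add: dist_commute)
    have sub: "?Q \<subseteq> ball x (3 * r)"
    proof
      fix y assume "y \<in> ?Q"
      then show "y \<in> ball x (3 * r)"
        using z s dist_triangle[of x y z] dist_triangle[of z y x0] by (simp add: dist_commute)
    qed
    have "(\<integral>\<^sup>+y\<in>ball x r. f y \<partial>lebesgue)
        \<le> (\<integral>\<^sup>+y. f y * indicator (ball x (3 * r) - ?Q) y + f y * indicator ?Q y \<partial>lebesgue)"
      using r by (intro nn_integral_mono) (auto split: split_indicator)
    also have "\<dots> = (\<integral>\<^sup>+y\<in>ball x (3 * r) - ?Q. f y \<partial>lebesgue) + (\<integral>\<^sup>+y\<in>?Q. f y \<partial>lebesgue)"
      by (rule nn_integral_add) measurable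
    also have "\<dots> \<le> (\<integral>\<^sup>+y\<in>ball x (3 * r) - ?Q. h y \<partial>lebesgue) + (\<integral>\<^sup>+y\<in>?Q. h y \<partial>lebesgue)"
      using far by (intro add_mono[OF nn_integral_mono near]) (auto split: split_indicator)
    also have "\<dots> = (\<integral>\<^sup>+y. h y * indicator (ball x (3 * r) - ?Q) y + h y * indicator ?Q y \<partial>lebesgue)"
      by (rule nn_integral_add[symmetric]) measurable
    also have "\<dots> \<le> (\<integral>\<^sup>+y\<in>ball x (3 * r). h y \<partial>lebesgue)"
      using sub by (intro nn_integral_mono) (auto split: split_indicator)
    finally show ?thesis .
  qed
  also have "\<dots> \<le> HL_maximal h x * emeasure lebesgue (ball x (3 * r))" using r by (intro avg) simp
  also have "\<dots> = 3 ^ DIM('a) * HL_maximal h x * emeasure lebesgue (ball x r)"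
    unfolding ball3 by (simp only: mult_ac)
  finally show "(\<integral>\<^sup>+y\<in>ball x r. f y \<partial>lebesgue) \<le> 3 ^ DIM('a) * HL_maximal h x * emeasure lebesgue (ball x r)" .
qed

context log_Hoelder_exponent begin

section \<open>Modular, Luxemburg norm and integrals near a point\<close>

lemma modular_mono:
  assumes "E \<subseteq> F" "F \<subseteq> \<Omega>" "\<And>x. x \<in> E \<Longrightarrow> \<bar>f x\<bar> \<le> \<bar>g x\<bar>"
  shows "modular E f \<le> modular F g"
  unfolding modular_def
proof (intro nn_integral_mono)
  fix x
  have "\<bar>f x\<bar> powr p x \<le> \<bar>g x\<bar> powr p x" if "x \<in> E"
    using that assms one_less_p[of x] by (intro powr_mono2) auto
  then show "ennreal (\<bar>f x\<bar> powr p x) * indicator E x \<le> ennreal (\<bar>g x\<bar> powr p x) * indicator F x"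
    using assms(1) by (auto split: split_indicator intro: ennreal_leI)
qed

lemma modular_le_of_luxemburg_norm_less:
  assumes "E \<subseteq> \<Omega>" "luxemburg_norm p E f < ennreal c"
  shows "modular E (\<lambda>x. f x / c) \<le> 1"
proof -
  obtain \<eta> where \<eta>: "0 < \<eta>" "modular E (\<lambda>x. f x / \<eta>) \<le> 1" "ennreal \<eta> < ennreal c"
    using assms(2) unfolding luxemburg_norm_def modular_def[symmetric] Inf_less_iff by auto
  have "\<eta> < c" using \<eta> by (simp add: ennreal_less_iff)
  have "modular E (\<lambda>x. f x / c) \<le> modular E (\<lambda>x. f x / \<eta>)"
    using assms(1) \<eta> \<open>\<eta> < c\<close> by (intro modular_mono) (auto simp: abs_divide intro!: divide_left_mono)
  then show ?thesis using \<eta> by simp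
qed

lemma luxemburg_norm_le:
  assumes "0 < c" "modular E (\<lambda>x. f x / c) \<le> 1"
  shows "luxemburg_norm p E f \<le> ennreal c"
  unfolding luxemburg_norm_def using assms by (intro Inf_lower) (auto simp: modular_def)

lemma maximal_op_finite_AE:
  assumes f: "f \<in> borel_measurable (lebesgue_on \<Omega>)" and mod: "modular \<Omega> f \<le> 1"
  shows "AE x in lebesgue. maximal_op \<Omega> f x < \<infinity>"
  unfolding maximal_op_eq_HL_maximal
proof (rule HL_maximal_finite_AE)
  show "(\<lambda>y. ennreal \<bar>f y\<bar> * indicator \<Omega> y) \<in> borel_measurable lebesgue"
    using f by (intro borel_measurable_times_indicator_subset[OF _ \<Omega>_sets]) auto
  have "(\<integral>\<^sup>+y\<in>\<Omega>. ennreal \<bar>f y\<bar> \<partial>lebesgue) \<le> ennreal (measure lebesgue \<Omega>) + 1"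
    using set_nn_integral_abs_le_modular[OF f \<Omega>_sets order_refl] mod
    unfolding emeasure_\<Omega> by (meson add_left_mono order_trans)
  also have "\<dots> < \<infinity>" by simp
  finally show "(\<integral>\<^sup>+y\<in>\<Omega>. ennreal \<bar>f y\<bar> \<partial>lebesgue) < \<infinity>" .
qed

end

locale log_Hoelder_exponent_at = log_Hoelder_exponent +
  fixes x0 :: 'a
  assumes x0: "x0 \<in> \<Omega>"
begin

definition n :: real where "n = real DIM('a)"

definition \<beta> :: real where "\<beta> = n / conj_exponent p x0"

lemma n_ge_1: "1 \<le> n" by (simp add: n_def)

lemma p_x0: "1 < p x0" using one_less_p x0 by simp

lemma \<beta>_eq: "\<beta> = n - n / p x0"
  using p_x0 by (simp add: \<beta>_def conj_exponent_def field_simps)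

lemma \<beta>_pos: "0 < \<beta>"
  using p_x0 n_ge_1 by (simp add: \<beta>_def conj_exponent_def)

lemma powr_exponent_difference_bounded:
  obtains D where "1 \<le> D"
    "\<And>\<rho> y. \<lbrakk>0 < \<rho>; \<rho> \<le> R; y \<in> \<Omega>; dist x0 y \<le> \<rho>\<rbrakk> \<Longrightarrow> \<rho> powr (n / p x0 * (p y - p x0)) \<le> D"
    "\<And>\<rho> y. \<lbrakk>0 < \<rho>; \<rho> \<le> R; y \<in> \<Omega>; dist x0 y \<le> \<rho>\<rbrakk> \<Longrightarrow> \<rho> powr (n / p x0 * (p x0 - p y)) \<le> D"
proof -
  obtain D0 where D0: "0 \<le> D0"
    "\<And>x y \<rho>. \<lbrakk>x \<in> \<Omega>; y \<in> \<Omega>; 0 < \<rho>; \<rho> \<le> R; norm (x - y) \<le> \<rho>\<rbrakk> \<Longrightarrow> \<bar>p x - p y\<bar> * \<bar>ln \<rho>\<bar> \<le> D0"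
    by (rule exponent_difference_ln_bounded[of R]) (blast intro: that)
  have *: "\<rho> powr (n / p x0 * e) \<le> exp (n * D0)"
    if "0 < \<rho>" "\<rho> \<le> R" "y \<in> \<Omega>" "dist x0 y \<le> \<rho>" "\<bar>e\<bar> = \<bar>p x0 - p y\<bar>" for \<rho> y e
  proof -
    have "e * ln \<rho> \<le> \<bar>p x0 - p y\<bar> * \<bar>ln \<rho>\<bar>"
      unfolding that(5)[symmetric] abs_mult[symmetric] by simp
    also have "\<dots> \<le> D0" using D0(2)[OF x0 that(3)] that by (simp add: dist_norm)
    finally have "n / p x0 * (e * ln \<rho>) \<le> n / p x0 * D0"
      using n_ge_1 p_x0 by (intro mult_left_mono) auto
    also have "\<dots> \<le> n * D0"
      using n_ge_1 p_x0 D0(1) by (intro mult_right_mono) (auto simp: field_simps)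
    finally show ?thesis using that(1) by (simp add: powr_def mult_ac)
  qed
  show thesis
    by (rule that[of "exp (n * D0)"]) (use D0 n_ge_1 * in \<open>auto simp: abs_minus_commute\<close>)
qed

text \<open>Hoelder's inequality against the characteristic function of a small ball. Splitting at height
\<open>\<rho> powr (- n / p x0)\<close>, the natural size of a normalised function on that ball, makes both terms
equal to \<open>\<rho> powr \<beta>\<close> up to the bounded factor \<open>\<rho> powr (n / p x0 * (p x - p x0))\<close>.\<close>
lemma set_nn_integral_ball_le:
  obtains C where "1 \<le> C"
    "\<And>E f c \<rho>. \<lbrakk>f \<in> borel_measurable (lebesgue_on \<Omega>); E \<in> sets lebesgue; E \<subseteq> \<Omega> \<inter> ball x0 \<rho>;
        0 < \<rho>; \<rho> \<le> R; 0 < c; modular E (\<lambda>x. f x / c) \<le> 1\<rbrakk>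
      \<Longrightarrow> (\<integral>\<^sup>+x\<in>E. ennreal \<bar>f x\<bar> \<partial>lebesgue) \<le> ennreal (C * \<rho> powr \<beta> * c)"
proof -
  obtain D where D: "1 \<le> D"
    "\<And>\<rho> y. \<lbrakk>0 < \<rho>; \<rho> \<le> R; y \<in> \<Omega>; dist x0 y \<le> \<rho>\<rbrakk> \<Longrightarrow> \<rho> powr (n / p x0 * (p y - p x0)) \<le> D"
    by (rule powr_exponent_difference_bounded[of R]) (blast intro: that)
  let ?v = "vol1 TYPE('a)"
  show thesis
  proof (rule that[of "?v + D"])
    show "1 \<le> ?v + D" using D vol1_pos[where 'a='a] by linarith
    fix E f c \<rho>
    assume f: "f \<in> borel_measurable (lebesgue_on \<Omega>)" and E: "E \<in> sets lebesgue" "E \<subseteq> \<Omega> \<inter> ball x0 \<rho>"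
      and \<rho>: "0 < \<rho>" "\<rho> \<le> R" and c: "0 < c" and mod: "modular E (\<lambda>x. f x / c) \<le> 1"
    have E\<Omega>: "E \<subseteq> \<Omega>" using E by auto
    have fc: "(\<lambda>x. f x / c) \<in> borel_measurable (lebesgue_on \<Omega>)" using f by measurable
    define G where "G x = ennreal (\<bar>f x / c\<bar> powr p x) * indicator E x" for x
    have G[measurable]: "G \<in> borel_measurable lebesgue"
      unfolding G_def by (rule modular_integrand_measurable[OF fc E(1) E\<Omega>])
    note E(1)[measurable]
    define a where "a = \<rho> powr (- (n / p x0))"
    have a: "0 < a" using \<rho> by (simp add: a_def)
    define b where "b = \<rho> powr \<beta> * D"
    have b: "0 < b" using \<rho> D by (simp add: b_def)
    have pt: "\<bar>f x\<bar> \<le> c * a + c * b * (\<bar>f x / c\<bar> powr p x)" if x: "x \<in> E" for x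
    proof -
      have "- (n / p x0) * (1 - p x) = \<beta> + n / p x0 * (p x - p x0)"
        using p_x0 by (simp add: \<beta>_eq field_simps)
      then have "a powr (1 - p x) = \<rho> powr \<beta> * \<rho> powr (n / p x0 * (p x - p x0))"
        by (simp only: a_def powr_powr powr_add)
      also have "\<dots> \<le> b"
      proof -
        have "x \<in> \<Omega>" "dist x0 x \<le> \<rho>" using subsetD[OF E(2) x] by auto
        then show ?thesis unfolding b_def using D(2)[OF \<rho>] by (intro mult_left_mono) auto
      qed
      finally have ab: "a powr (1 - p x) \<le> b" .
      have "\<bar>f x / c\<bar> \<le> a + \<bar>f x / c\<bar> powr p x * a powr (1 - p x)"
        using a one_less_p[of x] x E by (intro le_add_powr_mult_powr) auto
      also have "\<dots> \<le> a + \<bar>f x / c\<bar> powr p x * b"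
        using ab by (intro add_left_mono mult_left_mono) auto
      finally have "c * \<bar>f x / c\<bar> \<le> c * (a + \<bar>f x / c\<bar> powr p x * b)" using c by (intro mult_left_mono) auto
      then show ?thesis using c by (simp add: algebra_simps abs_divide)
    qed
    have "(\<integral>\<^sup>+x\<in>E. ennreal \<bar>f x\<bar> \<partial>lebesgue)
      \<le> (\<integral>\<^sup>+x. ennreal (c * a) * indicator E x + ennreal (c * b) * (ennreal (\<bar>f x / c\<bar> powr p x) * indicator E x) \<partial>lebesgue)"
    proof (intro nn_integral_mono)
      fix x
      show "ennreal \<bar>f x\<bar> * indicator E x
        \<le> ennreal (c * a) * indicator E x + ennreal (c * b) * (ennreal (\<bar>f x / c\<bar> powr p x) * indicator E x)"
      proof (cases "x \<in> E")
        case True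
        have "ennreal \<bar>f x\<bar> \<le> ennreal (c * a + c * b * (\<bar>f x / c\<bar> powr p x))" by (intro ennreal_leI pt True)
        also have "\<dots> = ennreal (c * a) + ennreal (c * b) * ennreal (\<bar>f x / c\<bar> powr p x)"
          using a b c by (simp only: ennreal_plus ennreal_mult mult_nonneg_nonneg less_imp_le powr_ge_zero)
        finally show ?thesis using True by simp
      qed simp
    qed
    also have "\<dots> = (\<integral>\<^sup>+x. ennreal (c * a) * indicator E x \<partial>lebesgue) + (\<integral>\<^sup>+x. ennreal (c * b) * G x \<partial>lebesgue)"
      unfolding G_def[symmetric] by (rule nn_integral_add) measurable
    also have "\<dots> = ennreal (c * a) * emeasure lebesgue E + ennreal (c * b) * (\<integral>\<^sup>+x. G x \<partial>lebesgue)"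
      using nn_integral_cmult[OF G] nn_integral_cmult_indicator[OF E(1)] by (simp only:)
    also have "(\<integral>\<^sup>+x. G x \<partial>lebesgue) = modular E (\<lambda>x. f x / c)" by (simp add: G_def modular_def)
    also have "ennreal (c * a) * emeasure lebesgue E + ennreal (c * b) * modular E (\<lambda>x. f x / c)
        \<le> ennreal (c * a) * ennreal (?v * \<rho> ^ DIM('a)) + ennreal (c * b) * 1"
    proof (intro add_mono mult_left_mono)
      have "emeasure lebesgue E \<le> emeasure lebesgue (ball x0 \<rho>)" using E by (intro emeasure_mono) auto
      then show "emeasure lebesgue E \<le> ennreal (?v * \<rho> ^ DIM('a))" using \<rho> emeasure_lebesgue_ball[of \<rho> x0] by simp
    qed (use mod in auto)
    also have "\<dots> = ennreal (c * a * (?v * \<rho> ^ DIM('a)) + c * b)"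
      using a b c \<rho> by (simp add: ennreal_mult[symmetric] ennreal_plus[symmetric] del: ennreal_plus)
    also have "c * a * (?v * \<rho> ^ DIM('a)) + c * b = (?v + D) * \<rho> powr \<beta> * c"
    proof -
      have "a * \<rho> ^ DIM('a) = \<rho> powr \<beta>"
        using \<rho> by (simp add: a_def \<beta>_eq n_def powr_add[symmetric] flip: powr_realpow)
      then have "c * a * (?v * \<rho> ^ DIM('a)) = ?v * \<rho> powr \<beta> * c"
        by (metis mult.assoc mult.commute)
      then show ?thesis by (simp add: b_def algebra_simps)
    qed
    finally show "(\<integral>\<^sup>+x\<in>E. ennreal \<bar>f x\<bar> \<partial>lebesgue) \<le> ennreal ((?v + D) * \<rho> powr \<beta> * c)" .
  qed
qed

end

section \<open>Consequences of the Hardy condition on the weights\<close>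

lemma powr_le_of_le_four_mult:
  fixes s t b :: real
  assumes "0 < s" "t \<le> 4 * s" "0 < t" "0 \<le> b"
  shows "t powr b \<le> 4 powr b * s powr b"
proof -
  have "t powr b \<le> (4 * s) powr b" using assms by (intro powr_mono2) auto
  then show ?thesis using assms by (simp add: powr_mult)
qed

locale complementary_Morrey_weights = log_Hoelder_exponent_at +
  fixes \<omega>1 \<omega>2 :: "real \<Rightarrow> real" and C\<^sub>H :: real
  assumes \<omega>1_measurable: "\<omega>1 \<in> borel_measurable (lebesgue_on {0<..<diameter \<Omega>})"
    and \<omega>1_pos: "r \<in> {0<..<diameter \<Omega>} \<Longrightarrow> 0 < \<omega>1 r"
    and \<omega>2_pos: "r \<in> {0<..<diameter \<Omega>} \<Longrightarrow> 0 < \<omega>2 r"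
    and CH_pos: "0 < C\<^sub>H"
    and Hardy: "t \<in> {0<..<diameter \<Omega>} \<Longrightarrow>
      (\<integral>\<^sup>+r\<in>{0<..<t}. ennreal (\<omega>1 r / r) \<partial>lebesgue) \<le> ennreal (C\<^sub>H * \<omega>2 t)"
begin

text \<open>The statement that the complementary Morrey norm of \<open>f\<close> for \<open>\<omega>1\<close> is at most \<open>\<eta>\<close>, expressed through modulars.
Unlike the Luxemburg norm, the modular is additive over disjoint sets.\<close>
definition complement_modular_bounded :: "('a \<Rightarrow> real) \<Rightarrow> real \<Rightarrow> bool" where
  "complement_modular_bounded f \<eta> \<longleftrightarrow> (\<forall>s\<in>{0<..<diameter \<Omega>}.
     modular (\<Omega> - ball x0 s) (\<lambda>x. f x / (\<eta> * \<omega>1 s * s powr (- \<beta>))) \<le> 1)"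

lemma nn_integral_const_interval:
  assumes "0 \<le> (c::real)" "a \<le> b"
  shows "(\<integral>\<^sup>+r\<in>{a<..<b}. ennreal c \<partial>lebesgue) = ennreal (c * (b - a))"
  using assms by (simp add: nn_integral_cmult_indicator ennreal_mult)

text \<open>The weight \<open>\<omega>1\<close> may oscillate, so it is compared with \<open>\<omega>2 t\<close> only at some radius of the scale \<open>t\<close>:
if \<open>\<omega>1\<close> were large on the whole interval, its Hardy integral would be too large. The interval has
measure at least \<open>1/2\<close> for \<open>ds/s\<close>, so any constant above 2 would do in place of 3.\<close>
lemma exists_small_weight:
  assumes t: "t \<in> {0<..<diameter \<Omega>}"
  obtains s where "t / 4 < s" "s < t / 2" "\<omega>1 s \<le> 3 * C\<^sub>H * \<omega>2 t"
proof (rule ccontr)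
  let ?c = "3 * C\<^sub>H * \<omega>2 t"
  note found = that
  assume "\<not> thesis"
  then have big: "?c < \<omega>1 s" if "s \<in> {t/4<..<t/2}" for s using that found[of s] by force
  have w: "0 < \<omega>2 t" using t \<omega>2_pos by blast
  have "ennreal (?c / (t/2) * (t/2 - t/4)) = (\<integral>\<^sup>+r\<in>{t/4<..<t/2}. ennreal (?c / (t/2)) \<partial>lebesgue)"
    using t w CH_pos by (intro nn_integral_const_interval[symmetric]) auto
  also have "\<dots> \<le> (\<integral>\<^sup>+r\<in>{0<..<t}. ennreal (\<omega>1 r / r) \<partial>lebesgue)"
  proof (intro nn_integral_mono)
    fix r
    have "?c / (t/2) \<le> \<omega>1 r / r" if r: "r \<in> {t/4<..<t/2}"
    proof (rule frac_le)
      have "r \<in> {0<..<diameter \<Omega>}" using r t by auto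
      then show "0 \<le> \<omega>1 r" using \<omega>1_pos by (simp add: less_imp_le)
    qed (use big[OF r] r t in auto)
    then show "ennreal (?c / (t/2)) * indicator {t/4<..<t/2} r \<le> ennreal (\<omega>1 r / r) * indicator {0<..<t} r"
      using t by (auto split: split_indicator intro: ennreal_leI)
  qed
  also have "\<dots> \<le> ennreal (C\<^sub>H * \<omega>2 t)" using Hardy[OF t] .
  finally have "?c / (t/2) * (t/2 - t/4) \<le> C\<^sub>H * \<omega>2 t" using w CH_pos by simp
  moreover have "?c / (t/2) * (t/2 - t/4) = ?c / 2" using t by (simp add: field_simps)
  ultimately show False using mult_pos_pos[OF CH_pos w] by simp
qed

lemma modular_far_part_le_1:
  assumes t: "t \<in> {0<..<diameter \<Omega>}" and \<eta>: "0 < \<eta>" and f: "complement_modular_bounded f \<eta>"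
  shows "modular (\<Omega> - ball x0 (t / 2)) (\<lambda>x. f x / (3 * C\<^sub>H * 4 powr \<beta> * (\<eta> * \<omega>2 t * t powr (- \<beta>)))) \<le> 1"
proof -
  obtain s where s: "t / 4 < s" "s < t / 2" "\<omega>1 s \<le> 3 * C\<^sub>H * \<omega>2 t"
    by (rule exists_small_weight[OF t])
  have s': "s \<in> {0<..<diameter \<Omega>}" using s t by auto
  have w: "0 < \<omega>1 s" "0 < \<omega>2 t" using \<omega>1_pos[OF s'] \<omega>2_pos[OF t] by auto
  have "t powr \<beta> \<le> 4 powr \<beta> * s powr \<beta>"
    using s s' t \<beta>_pos by (intro powr_le_of_le_four_mult) auto
  then have st: "s powr (- \<beta>) \<le> 4 powr \<beta> * t powr (- \<beta>)"
    using s' t by (simp add: powr_minus field_simps)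
  have "\<eta> * \<omega>1 s * s powr (- \<beta>) \<le> \<eta> * (3 * C\<^sub>H * \<omega>2 t) * (4 powr \<beta> * t powr (- \<beta>))"
    using s(3) st \<eta> w CH_pos by (intro mult_mono mult_left_mono) auto
  also have "\<dots> = 3 * C\<^sub>H * 4 powr \<beta> * (\<eta> * \<omega>2 t * t powr (- \<beta>))" by simp
  finally have le: "\<eta> * \<omega>1 s * s powr (- \<beta>) \<le> 3 * C\<^sub>H * 4 powr \<beta> * (\<eta> * \<omega>2 t * t powr (- \<beta>))" .
  have pos: "0 < \<eta> * \<omega>1 s * s powr (- \<beta>)" using \<eta> w s' by simp
  have "modular (\<Omega> - ball x0 (t / 2)) (\<lambda>x. f x / (3 * C\<^sub>H * 4 powr \<beta> * (\<eta> * \<omega>2 t * t powr (- \<beta>))))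
      \<le> modular (\<Omega> - ball x0 s) (\<lambda>x. f x / (\<eta> * \<omega>1 s * s powr (- \<beta>)))"
  proof (rule modular_mono)
    show "\<Omega> - ball x0 (t / 2) \<subseteq> \<Omega> - ball x0 s" using s by auto
    fix x
    have "\<bar>y / d\<bar> \<le> \<bar>y / c\<bar>" if "0 < c" "c \<le> d" for y c d :: real
      using that by (simp add: abs_divide divide_left_mono)
    from this[OF pos le] show "\<bar>f x / (3 * C\<^sub>H * 4 powr \<beta> * (\<eta> * \<omega>2 t * t powr (- \<beta>)))\<bar>
        \<le> \<bar>f x / (\<eta> * \<omega>1 s * s powr (- \<beta>))\<bar>" .
  qed simp
  also have "\<dots> \<le> 1" using f s' unfolding complement_modular_bounded_def by blast
  finally show ?thesis .
qed

definition annulus :: "real \<Rightarrow> nat \<Rightarrow> 'a set" where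
  "annulus t k = {x \<in> \<Omega>. t / 2 ^ Suc k \<le> dist x0 x \<and> dist x0 x < t / 2 ^ k}"

text \<open>These radii lie strictly inside the inner radius of \<open>annulus t k\<close>, so that the annulus is contained in the
complement of the corresponding balls, yet they are comparable to it.\<close>
definition dyadic_interval :: "real \<Rightarrow> nat \<Rightarrow> real set" where
  "dyadic_interval t k = {t / 2 ^ (k + 2)<..<t / 2 ^ (k + 1)}"

lemma annulus_sets: "annulus t k \<in> sets lebesgue"
proof -
  have "annulus t k = \<Omega> \<inter> ball x0 (t / 2 ^ k) - ball x0 (t / 2 ^ Suc k)"
    by (auto simp: annulus_def)
  then show ?thesis by (simp only:) (intro sets.Diff sets.Int \<Omega>_sets; simp)
qed

lemma disjoint_dyadic_intervals:
  assumes t: "0 < t"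
  shows "disjoint_family (dyadic_interval t)"
proof -
  have *: "dyadic_interval t i \<inter> dyadic_interval t j = {}" if "i < j" for i j
  proof -
    have "(2::real) ^ (i + 2) \<le> 2 ^ (j + 1)" using that by (intro power_increasing) auto
    then have "t / 2 ^ (j + 1) \<le> t / 2 ^ (i + 2)" using t by (intro divide_left_mono) auto
    then show ?thesis by (auto simp: dyadic_interval_def)
  qed
  show ?thesis unfolding disjoint_family_on_def
  proof (intro ballI impI)
    fix i j :: nat assume "i \<noteq> j"
    then consider "i < j" | "j < i" by linarith
    then show "dyadic_interval t i \<inter> dyadic_interval t j = {}" using * by cases (auto simp: Int_commute)
  qed
qed

lemma dyadic_interval_subset:
  assumes "0 < t" shows "dyadic_interval t k \<subseteq> {0<..<t}"
proof -
  have "(1::real) \<le> 2 ^ (k + 1)" by (rule one_le_power) simp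
  then have "t / 2 ^ (k + 1) \<le> t / 1" using assms by (intro divide_left_mono) auto
  moreover have "0 < t / 2 ^ (k + 2)" using assms by simp
  ultimately show ?thesis by (auto simp: dyadic_interval_def)
qed

lemma punctured_ball_covered_by_annuli:
  assumes t: "0 < t" and x: "x \<in> \<Omega>" "x \<noteq> x0" "dist x0 x < t"
  obtains k where "x \<in> annulus t k"
proof -
  define P where "P k \<longleftrightarrow> t / 2 ^ k \<le> dist x0 x" for k :: nat
  have d: "0 < dist x0 x" using x by simp
  obtain k0 where "t / dist x0 x < 2 ^ k0" using real_arch_pow[of 2 "t / dist x0 x"] by auto
  then have "P k0" using d t by (simp add: P_def field_simps)
  define k where "k = (LEAST k. P k)"
  have Pk: "P k" unfolding k_def using \<open>P k0\<close> by (rule LeastI)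
  have "\<not> P 0" using x by (simp add: P_def)
  with Pk have "k \<noteq> 0" by metis
  then obtain j where j: "k = Suc j" by (cases k) auto
  have "\<not> P j" using not_less_Least[of j P] j by (simp add: k_def[symmetric])
  then have "x \<in> annulus t j" using Pk x by (auto simp: j P_def annulus_def)
  then show thesis by (rule that)
qed

text \<open>The mass of an annulus is bounded by a multiple of \<open>\<omega>1 s\<close> for every \<open>s\<close> in the dyadic interval just inside it.
Integrating this over the interval with respect to \<open>ds/s\<close>, which gives it mass at least \<open>1/2\<close>, replaces \<open>\<omega>1 s\<close>
by a piece of the Hardy integral, and the pieces for different annuli are disjoint.\<close>
lemma set_nn_integral_near_part_le:
  obtains C where "1 \<le> C"
    "\<And>f \<eta> t. \<lbrakk>f \<in> borel_measurable (lebesgue_on \<Omega>); 0 < \<eta>; complement_modular_bounded f \<eta>;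
        t \<in> {0<..<diameter \<Omega>}\<rbrakk>
      \<Longrightarrow> (\<integral>\<^sup>+x\<in>\<Omega> \<inter> ball x0 t. ennreal \<bar>f x\<bar> \<partial>lebesgue) \<le> ennreal (C * (\<eta> * \<omega>2 t))"
proof -
  let ?R = "diameter \<Omega>"
  obtain C where C: "1 \<le> C"
    "\<And>E f c \<rho>. \<lbrakk>f \<in> borel_measurable (lebesgue_on \<Omega>); E \<in> sets lebesgue; E \<subseteq> \<Omega> \<inter> ball x0 \<rho>;
        0 < \<rho>; \<rho> \<le> ?R; 0 < c; modular E (\<lambda>x. f x / c) \<le> 1\<rbrakk>
      \<Longrightarrow> (\<integral>\<^sup>+x\<in>E. ennreal \<bar>f x\<bar> \<partial>lebesgue) \<le> ennreal (C * \<rho> powr \<beta> * c)"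
    by (rule set_nn_integral_ball_le[of ?R]) (blast intro: that)
  define K where "K = 2 * C * 4 powr \<beta>"
  have K: "0 < K" using C by (simp add: K_def)
  show thesis
  proof (rule that[of "max 1 (K * C\<^sub>H)"])
    fix f \<eta> t
    assume f: "f \<in> borel_measurable (lebesgue_on \<Omega>)" and \<eta>: "0 < \<eta>"
      and cmb: "complement_modular_bounded f \<eta>" and t: "t \<in> {0<..<diameter \<Omega>}"
    have t0: "0 < t" using t by simp
    define J where "J k = (\<integral>\<^sup>+r\<in>dyadic_interval t k. ennreal (\<omega>1 r / r) \<partial>lebesgue)" for k
    have f_meas: "(\<lambda>x. ennreal \<bar>f x\<bar> * indicator E x) \<in> borel_measurable lebesgue"
      if "E \<in> sets lebesgue" "E \<subseteq> \<Omega>" for E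
      using f that by (intro borel_measurable_times_indicator_subset[OF _ \<Omega>_sets]) auto
    have w_meas: "(\<lambda>r. ennreal (\<omega>1 r / r) * indicator E r) \<in> borel_measurable lebesgue"
      if "E \<in> sets lebesgue" "E \<subseteq> {0<..<diameter \<Omega>}" for E
    proof (rule borel_measurable_times_indicator_subset[OF _ _ that])
      have "(\<lambda>r. r) \<in> borel_measurable (lebesgue_on {0<..<diameter \<Omega>})"
        using id_borel_measurable_lebesgue_on unfolding id_def .
      then show "(\<lambda>r. ennreal (\<omega>1 r / r)) \<in> borel_measurable (lebesgue_on {0<..<diameter \<Omega>})"
        using \<omega>1_measurable by measurable
    qed simp
    have I_sub: "dyadic_interval t k \<subseteq> {0<..<diameter \<Omega>}" for k
      using dyadic_interval_subset[OF t0, of k] t by auto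
    have I_sets[measurable]: "dyadic_interval t k \<in> sets lebesgue" for k by (simp add: dyadic_interval_def)
    have ann: "(\<integral>\<^sup>+x\<in>annulus t k. ennreal \<bar>f x\<bar> \<partial>lebesgue) \<le> ennreal (K * \<eta>) * J k" for k
    proof -
      let ?\<rho> = "t / 2 ^ k"
      have \<rho>: "0 < ?\<rho>" "?\<rho> \<le> ?R"
      proof -
        have "?\<rho> \<le> t / 1" using t0 by (intro divide_left_mono) auto
        then show "?\<rho> \<le> ?R" using t by auto
      qed (use t0 in auto)
      let ?X = "\<integral>\<^sup>+x\<in>annulus t k. ennreal \<bar>f x\<bar> \<partial>lebesgue"
      have each: "?X \<le> ennreal (C * 4 powr \<beta> * \<eta> * \<omega>1 s)" if s: "s \<in> dyadic_interval t k" for s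
      proof -
        have s': "s \<in> {0<..<diameter \<Omega>}" using s I_sub by blast
        have s4: "?\<rho> \<le> 4 * s" "s < t / 2 ^ Suc k" using s by (auto simp: dyadic_interval_def field_simps)
        let ?c = "\<eta> * \<omega>1 s * s powr (- \<beta>)"
        have c: "0 < ?c" using \<eta> \<omega>1_pos[OF s'] s' by simp
        have "modular (annulus t k) (\<lambda>x. f x / ?c) \<le> modular (\<Omega> - ball x0 s) (\<lambda>x. f x / ?c)"
          using s4 by (intro modular_mono) (auto simp: annulus_def)
        also have "\<dots> \<le> 1" using cmb s' unfolding complement_modular_bounded_def by blast
        finally have "?X \<le> ennreal (C * ?\<rho> powr \<beta> * ?c)"
          using \<rho> c by (intro C(2)[OF f annulus_sets]) (auto simp: annulus_def)
        also have "\<dots> \<le> ennreal (C * 4 powr \<beta> * \<eta> * \<omega>1 s)"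
        proof (rule ennreal_leI)
          have "?\<rho> powr \<beta> \<le> 4 powr \<beta> * s powr \<beta>"
            using s4 s' \<rho> \<beta>_pos by (intro powr_le_of_le_four_mult) auto
          then have "C * ?\<rho> powr \<beta> * ?c \<le> C * (4 powr \<beta> * s powr \<beta>) * ?c"
            using C c by (intro mult_right_mono mult_left_mono) auto
          also have "\<dots> = C * 4 powr \<beta> * \<eta> * \<omega>1 s" using s' by (simp add: powr_minus field_simps)
          finally show "C * ?\<rho> powr \<beta> * ?c \<le> C * 4 powr \<beta> * \<eta> * \<omega>1 s" .
        qed
        finally show ?thesis .
      qed
      let ?l = "1 / (t / 2 ^ (k + 1))"
      have len: "?l * (t / 2 ^ (k + 1) - t / 2 ^ (k + 2)) = 1 / 2"
        using t0 by (simp add: field_simps)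
      have "?X * ennreal (1 / 2) = ?X * (\<integral>\<^sup>+s\<in>dyadic_interval t k. ennreal ?l \<partial>lebesgue)"
      proof -
        have "0 \<le> ?l" "t / 2 ^ (k + 2) \<le> t / 2 ^ (k + 1)" using t0 by (auto simp: field_simps)
        from nn_integral_const_interval[OF this] show ?thesis by (simp only: dyadic_interval_def len)
      qed
      also have "\<dots> = (\<integral>\<^sup>+s. ?X * (ennreal ?l * indicator (dyadic_interval t k) s) \<partial>lebesgue)"
        by (intro nn_integral_cmult[symmetric]) measurable
      also have "\<dots> \<le> (\<integral>\<^sup>+s. ennreal (C * 4 powr \<beta> * \<eta>) * (ennreal (\<omega>1 s / s) * indicator (dyadic_interval t k) s) \<partial>lebesgue)"
      proof (intro nn_integral_mono)
        fix s
        show "?X * (ennreal ?l * indicator (dyadic_interval t k) s)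
          \<le> ennreal (C * 4 powr \<beta> * \<eta>) * (ennreal (\<omega>1 s / s) * indicator (dyadic_interval t k) s)"
        proof (cases "s \<in> dyadic_interval t k")
          case True
          have s': "s \<in> {0<..<diameter \<Omega>}" using True I_sub by blast
          have "?l \<le> 1 / s" using True s' by (intro frac_le) (auto simp: dyadic_interval_def)
          then have "?X * ennreal ?l \<le> ennreal (C * 4 powr \<beta> * \<eta> * \<omega>1 s) * ennreal (1 / s)"
            by (intro mult_mono each[OF True] ennreal_leI) auto
          also have "\<dots> = ennreal (C * 4 powr \<beta> * \<eta>) * ennreal (\<omega>1 s / s)"
            using C \<eta> \<omega>1_pos[OF s'] s' by (simp add: ennreal_mult[symmetric])
          finally show ?thesis using True by simp
        qed simp
      qed
      also have "\<dots> = ennreal (C * 4 powr \<beta> * \<eta>) * J k"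
        unfolding J_def by (rule nn_integral_cmult[OF w_meas[OF I_sets I_sub]])
      finally have "ennreal 2 * (?X * ennreal (1 / 2)) \<le> ennreal 2 * (ennreal (C * 4 powr \<beta> * \<eta>) * J k)"
        by (rule mult_left_mono) simp
      moreover have "ennreal 2 * (?X * ennreal (1 / 2)) = ?X"
      proof -
        have "ennreal 2 * ennreal (1 / 2) = ennreal (2 * (1 / 2))" by (rule ennreal_mult[symmetric]) auto
        then show ?thesis by (simp only: mult.left_commute[of "ennreal 2"]) simp
      qed
      moreover have "ennreal 2 * (ennreal (C * 4 powr \<beta> * \<eta>) * J k) = ennreal (K * \<eta>) * J k"
        unfolding K_def mult.assoc[symmetric] using C \<eta> by (subst ennreal_mult[symmetric]) (auto simp: mult_ac)
      ultimately show ?thesis by simp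
    qed
    have "AE x in lebesgue. x \<noteq> x0"
      by (intro AE_I'[of "{x0}"]) (auto simp: negligible_iff_null_sets[symmetric])
    then have "AE x in lebesgue. ennreal \<bar>f x\<bar> * indicator (\<Omega> \<inter> ball x0 t) x
        \<le> (\<Sum>k. ennreal \<bar>f x\<bar> * indicator (annulus t k) x)"
    proof eventually_elim
      fix x assume "x \<noteq> x0"
      show "ennreal \<bar>f x\<bar> * indicator (\<Omega> \<inter> ball x0 t) x \<le> (\<Sum>k. ennreal \<bar>f x\<bar> * indicator (annulus t k) x)"
      proof (cases "x \<in> \<Omega> \<inter> ball x0 t")
        case True
        then obtain k where k: "x \<in> annulus t k"
          using punctured_ball_covered_by_annuli[OF t0] \<open>x \<noteq> x0\<close> by (metis IntE mem_ball)
        have "F k \<le> suminf F" for F :: "nat \<Rightarrow> ennreal"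
          using sum_le_suminf[of F "{k}"] by auto
        from this[of "\<lambda>k. ennreal \<bar>f x\<bar> * indicator (annulus t k) x"] show ?thesis using True k by simp
      qed simp
    qed
    then have "(\<integral>\<^sup>+x\<in>\<Omega> \<inter> ball x0 t. ennreal \<bar>f x\<bar> \<partial>lebesgue)
        \<le> (\<integral>\<^sup>+x. (\<Sum>k. ennreal \<bar>f x\<bar> * indicator (annulus t k) x) \<partial>lebesgue)"
      by (rule nn_integral_mono_AE)
    also have "\<dots> = (\<Sum>k. \<integral>\<^sup>+x\<in>annulus t k. ennreal \<bar>f x\<bar> \<partial>lebesgue)"
      by (intro nn_integral_suminf f_meas annulus_sets) (auto simp: annulus_def)
    also have "\<dots> \<le> (\<Sum>k. ennreal (K * \<eta>) * J k)" by (intro suminf_le ann) auto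
    also have "\<dots> = ennreal (K * \<eta>) * (\<Sum>k. J k)" by simp
    also have "(\<Sum>k. J k) = (\<integral>\<^sup>+r. (\<Sum>k. ennreal (\<omega>1 r / r) * indicator (dyadic_interval t k) r) \<partial>lebesgue)"
      unfolding J_def by (intro nn_integral_suminf[symmetric] w_meas I_sets I_sub)
    also have "\<dots> \<le> (\<integral>\<^sup>+r\<in>{0<..<t}. ennreal (\<omega>1 r / r) \<partial>lebesgue)"
    proof (intro nn_integral_mono)
      fix r
      have "(\<Sum>k. ennreal (\<omega>1 r / r) * indicator (dyadic_interval t k) r)
          = ennreal (\<omega>1 r / r) * indicator (\<Union>k. dyadic_interval t k) r"
        using suminf_indicator[OF disjoint_dyadic_intervals[OF t0], of r] by simp
      also have "\<dots> \<le> ennreal (\<omega>1 r / r) * indicator {0<..<t} r"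
      proof -
        have "r \<in> (\<Union>k. dyadic_interval t k) \<Longrightarrow> r \<in> {0<..<t}"
          using dyadic_interval_subset[OF t0] by blast
        then show ?thesis by (auto simp only: indicator_def split: if_splits) auto
      qed
      finally show "(\<Sum>k. ennreal (\<omega>1 r / r) * indicator (dyadic_interval t k) r)
          \<le> ennreal (\<omega>1 r / r) * indicator {0<..<t} r" .
    qed
    also have "\<dots> \<le> ennreal (C\<^sub>H * \<omega>2 t)" by (rule Hardy[OF t])
    also have "ennreal (K * \<eta>) * ennreal (C\<^sub>H * \<omega>2 t) = ennreal (K * C\<^sub>H * (\<eta> * \<omega>2 t))"
      using K \<eta> CH_pos \<omega>2_pos[OF t] by (simp add: ennreal_mult[symmetric] mult_ac)
    also have "\<dots> \<le> ennreal (max 1 (K * C\<^sub>H) * (\<eta> * \<omega>2 t))"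
      using \<eta> \<omega>2_pos[OF t] by (intro ennreal_leI mult_right_mono) auto
    finally show "(\<integral>\<^sup>+x\<in>\<Omega> \<inter> ball x0 t. ennreal \<bar>f x\<bar> \<partial>lebesgue)
      \<le> ennreal (max 1 (K * C\<^sub>H) * (\<eta> * \<omega>2 t))"
      by (simp add: mult_left_mono)
  qed simp
qed

end

section \<open>The maximal operator on complementary Morrey spaces\<close>

lemma HL_maximal_cmult_le:
  fixes g :: "'a::euclidean_space \<Rightarrow> ennreal"
  assumes g[measurable]: "g \<in> borel_measurable lebesgue"
  shows "HL_maximal (\<lambda>y. c * g y) x \<le> c * HL_maximal g x"
  unfolding HL_maximal_le_iff[of "\<lambda>y. c * g y"]
proof (intro allI impI)
  fix r :: real assume r: "0 < r"
  have [measurable]: "ball x r \<in> sets lebesgue" by simp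
  have "(\<integral>\<^sup>+y\<in>ball x r. c * g y \<partial>lebesgue) = c * (\<integral>\<^sup>+y\<in>ball x r. g y \<partial>lebesgue)"
    by (simp add: mult.assoc nn_integral_cmult)
  also have "\<dots> \<le> c * (HL_maximal g x * emeasure lebesgue (ball x r))"
    using HL_maximal_le_iff[of g x "HL_maximal g x"] r by (intro mult_left_mono) auto
  finally show "(\<integral>\<^sup>+y\<in>ball x r. c * g y \<partial>lebesgue) \<le> c * HL_maximal g x * emeasure lebesgue (ball x r)"
    by (simp only: mult.assoc)
qed

context complementary_Morrey_weights begin

text \<open>The function \<open>h\<close> combines the far part of \<open>f\<close> with a constant on a small ball \<open>S\<close> carrying the near mass.
The two supports are disjoint, so the modular of \<open>h\<close> is a sum of two terms, each made at most \<open>1/2\<close> by the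
choice of the normalising constant \<open>L\<close>.\<close>
lemma maximal_op_complement_bound:
  obtains K where "0 < K"
    "\<And>f \<eta> t. \<lbrakk>f \<in> borel_measurable (lebesgue_on \<Omega>); 0 < \<eta>; complement_modular_bounded f \<eta>;
        t \<in> {0<..<diameter \<Omega>}\<rbrakk>
      \<Longrightarrow> (AE x in lebesgue. x \<in> \<Omega> - ball x0 t \<longrightarrow> maximal_op \<Omega> f x < \<infinity>) \<and>
          modular (\<Omega> - ball x0 t)
            (\<lambda>x. enn2real (maximal_op \<Omega> f x) / (K * (\<eta> * \<omega>2 t * t powr (- \<beta>)))) \<le> 1"
proof -
  let ?R = "diameter \<Omega>"
  obtain e where e: "0 < e" "ball x0 e \<subseteq> \<Omega>" using open_\<Omega> x0 by (meson open_contains_ball)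
  have R0: "0 \<le> ?R" by (rule diameter_ge_0[OF bounded_\<Omega>])
  \<comment> \<open>The factor \<open>k\<close> makes \<open>ball x0 (k * t)\<close> lie in \<open>\<Omega>\<close> for all \<open>t\<close> below the diameter at once;
    \<open>k \<le> 1/2\<close> puts it inside the near region.\<close>
  define k where "k = min (1/2) (e / (?R + 1))"
  have k: "0 < k" "k \<le> 1/2" "k \<le> e / (?R + 1)"
    unfolding k_def by (use e R0 in simp, rule min.cobounded1, rule min.cobounded2)
  have kt: "k * t \<le> e" if "t \<in> {0<..<?R}" for t
  proof -
    have "k * t \<le> e / (?R + 1) * (?R + 1)" using that k e by (intro mult_mono) auto
    then show ?thesis using R0 by simp
  qed
  obtain C3 where C3: "1 \<le> C3"
    "\<And>f \<eta> t. \<lbrakk>f \<in> borel_measurable (lebesgue_on \<Omega>); 0 < \<eta>; complement_modular_bounded f \<eta>;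
        t \<in> {0<..<diameter \<Omega>}\<rbrakk>
      \<Longrightarrow> (\<integral>\<^sup>+x\<in>\<Omega> \<inter> ball x0 t. ennreal \<bar>f x\<bar> \<partial>lebesgue) \<le> ennreal (C3 * (\<eta> * \<omega>2 t))"
    by (rule set_nn_integral_near_part_le) (blast intro: that)
  obtain D where D: "1 \<le> D"
    "\<And>\<rho> y. \<lbrakk>0 < \<rho>; \<rho> \<le> ?R; y \<in> \<Omega>; dist x0 y \<le> \<rho>\<rbrakk> \<Longrightarrow> \<rho> powr (n / p x0 * (p x0 - p y)) \<le> D"
    by (rule powr_exponent_difference_bounded[of ?R]) (blast intro: that)
  obtain KM where KM: "1 \<le> KM"
    "\<And>f. \<lbrakk>f \<in> borel_measurable (lebesgue_on \<Omega>); modular \<Omega> f \<le> 1\<rbrakk>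
     \<Longrightarrow> modular \<Omega> (\<lambda>x. enn2real (maximal_op \<Omega> f x) / KM) \<le> 1"
    by (rule maximal_op_modular_bound) (blast intro: that)
  define q where "q = vol1 TYPE('a) * k ^ DIM('a)"
  have q: "0 < q" using k by (simp add: q_def)
  define C4 where "C4 = C3 / q"
  have C4: "0 < C4" using C3 q by (simp add: C4_def)
  define L1 where "L1 = 3 * C\<^sub>H * 4 powr \<beta>"
  have L1: "0 < L1" using CH_pos by (simp add: L1_def)
  \<comment> \<open>The three summands serve, in turn, the far part, the bound \<open>C4 / L \<le> 1\<close> needed to drop a
    power \<open>p x \<ge> 1\<close>, and the integral over \<open>S\<close>.\<close>
  define L where "L = 2 * L1 + C4 + 2 * C4 * D * q"
  have "0 < C4 * D * q" using C4 D q by simp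
  then have L: "0 < L" "2 * L1 \<le> L" "C4 \<le> L" "2 * C4 * D * q \<le> L"
    using L1 C4 by (auto simp: L_def)
  define K where "K = L * 3 ^ DIM('a) * KM"
  show thesis
  proof (rule that[of K])
    show "0 < K" using L KM by (simp add: K_def)
    fix f \<eta> t
    assume f: "f \<in> borel_measurable (lebesgue_on \<Omega>)" and \<eta>: "0 < \<eta>"
      and cmb: "complement_modular_bounded f \<eta>" and t: "t \<in> {0<..<diameter \<Omega>}"
    have t0: "0 < t" and tR: "t \<le> ?R" using t by auto
    have w2: "0 < \<omega>2 t" using \<omega>2_pos[OF t] .
    define \<Lambda> where "\<Lambda> = \<eta> * \<omega>2 t * t powr (- \<beta>)"
    have \<Lambda>: "0 < \<Lambda>" using \<eta> w2 t0 by (simp add: \<Lambda>_def)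
    define S where "S = ball x0 (k * t)"
    define Q where "Q = ball x0 (t / 2)"
    have SQ: "S \<subseteq> Q" using k t0 by (auto simp: S_def Q_def intro!: subset_ball)
    have S\<Omega>: "S \<subseteq> \<Omega>" using kt[OF t] e by (auto simp: S_def)
    have S[measurable]: "S \<in> sets lebesgue" and Q[measurable]: "Q \<in> sets lebesgue"
      by (auto simp: S_def Q_def)
    have emS: "emeasure lebesgue S = ennreal (q * t powr n)"
      using emeasure_lebesgue_ball[of "k * t" x0] k t0
      by (simp add: S_def q_def n_def powr_realpow power_mult_distrib mult.assoc)
    define m where "m = enn2real (\<integral>\<^sup>+x\<in>\<Omega> \<inter> Q. ennreal \<bar>f x\<bar> \<partial>lebesgue)"
    have le: "(\<integral>\<^sup>+x\<in>\<Omega> \<inter> Q. ennreal \<bar>f x\<bar> \<partial>lebesgue) \<le> ennreal (C3 * (\<eta> * \<omega>2 t))"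
    proof -
      have "(\<integral>\<^sup>+x\<in>\<Omega> \<inter> Q. ennreal \<bar>f x\<bar> \<partial>lebesgue) \<le> (\<integral>\<^sup>+x\<in>\<Omega> \<inter> ball x0 t. ennreal \<bar>f x\<bar> \<partial>lebesgue)"
        using t0 by (intro nn_integral_mono) (auto simp: Q_def split: split_indicator)
      then show ?thesis using C3(2)[OF f \<eta> cmb t] by (rule order_trans)
    qed
    have m: "(\<integral>\<^sup>+x\<in>\<Omega> \<inter> Q. ennreal \<bar>f x\<bar> \<partial>lebesgue) = ennreal m" "0 \<le> m" "m \<le> C3 * (\<eta> * \<omega>2 t)"
    proof -
      show 1: "(\<integral>\<^sup>+x\<in>\<Omega> \<inter> Q. ennreal \<bar>f x\<bar> \<partial>lebesgue) = ennreal m"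
        using le_less_trans[OF le ennreal_less_top] by (simp add: m_def)
      show "0 \<le> m" by (simp add: m_def)
      have "0 \<le> C3 * (\<eta> * \<omega>2 t)" using C3 \<eta> w2 by simp
      then show "m \<le> C3 * (\<eta> * \<omega>2 t)" using le unfolding 1 by simp
    qed
    define w where "w = m / (q * t powr n)"
    have w: "0 \<le> w" "w * (q * t powr n) = m" using m q t0 by (auto simp: w_def)
    have wL: "w / (L * \<Lambda>) \<le> C4 / L * t powr (- (n / p x0))"
    proof -
      have "w \<le> C3 * (\<eta> * \<omega>2 t) / (q * t powr n)"
        unfolding w_def using m q by (intro divide_right_mono) auto
      also have "\<dots> = C4 * \<Lambda> * (t powr \<beta> / t powr n)"
        using t0 by (simp add: C4_def \<Lambda>_def powr_minus)
      also have "t powr \<beta> / t powr n = t powr (- (n / p x0))"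
        by (simp add: powr_diff[symmetric] \<beta>_eq)
      finally have "w / (L * \<Lambda>) \<le> C4 * \<Lambda> * t powr (- (n / p x0)) / (L * \<Lambda>)"
        using L \<Lambda> by (intro divide_right_mono) auto
      then show ?thesis using \<Lambda> by simp
    qed
    define h where "h y = (indicator S y * w + indicator (\<Omega> - Q) y * f y) / (L * \<Lambda>)" for y
    have h_S: "h y = w / (L * \<Lambda>)" if "y \<in> S" for y using that SQ by (auto simp: h_def)
    have h_far: "h y = f y / (L * \<Lambda>)" if "y \<in> \<Omega> - Q" for y using that SQ by (auto simp: h_def split: split_indicator)
    have h_else: "h y = 0" if "y \<notin> S" "y \<notin> \<Omega> - Q" for y using that by (simp add: h_def)
    have h: "h \<in> borel_measurable (lebesgue_on \<Omega>)"
    proof -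
      have [measurable]: "S \<in> sets (lebesgue_on \<Omega>)" "\<Omega> - Q \<in> sets (lebesgue_on \<Omega>)"
        using S Q S\<Omega> \<Omega>_sets by (auto simp: sets_restrict_space_iff)
      note f[measurable]
      show ?thesis unfolding h_def by measurable
    qed
    have modh: "modular \<Omega> h \<le> 1"
    proof -
      have far_meas[measurable]: "(\<lambda>x. ennreal (\<bar>f x / (L1 * \<Lambda>)\<bar> powr p x) * indicator (\<Omega> - Q) x) \<in> borel_measurable lebesgue"
        using f by (intro modular_integrand_measurable) auto
      have "modular \<Omega> h \<le> (\<integral>\<^sup>+x. ennreal (1 / (2 * (q * t powr n))) * indicator S x +
          ennreal (1/2) * (ennreal (\<bar>f x / (L1 * \<Lambda>)\<bar> powr p x) * indicator (\<Omega> - Q) x) \<partial>lebesgue)"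
        unfolding modular_def
      proof (intro nn_integral_mono)
        fix x
        consider "x \<in> S" | "x \<in> \<Omega> - Q" | "x \<notin> S" "x \<notin> \<Omega> - Q" by blast
        then show "ennreal (\<bar>h x\<bar> powr p x) * indicator \<Omega> x \<le> ennreal (1 / (2 * (q * t powr n))) * indicator S x +
          ennreal (1/2) * (ennreal (\<bar>f x / (L1 * \<Lambda>)\<bar> powr p x) * indicator (\<Omega> - Q) x)"
        proof cases
          case 1
          then have x: "x \<in> \<Omega>" "dist x0 x \<le> t" using S\<Omega> SQ t0 by (auto simp: Q_def)
          have px: "1 < p x" using one_less_p x by simp
          have "\<bar>h x\<bar> powr p x \<le> (C4 / L * t powr (- (n / p x0))) powr p x"
            using wL w L \<Lambda> px by (intro powr_mono2) (auto simp: h_S[OF 1])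
          also have "\<dots> = (C4 / L) powr p x * t powr (- (n / p x0) * p x)"
            by (simp only: powr_mult powr_powr)
          also have "- (n / p x0) * p x = - n + n / p x0 * (p x0 - p x)"
            using p_x0 by (simp add: field_simps)
          also have "(C4 / L) powr p x * t powr (- n + n / p x0 * (p x0 - p x))
              = (C4 / L) powr p x * t powr (- n) * t powr (n / p x0 * (p x0 - p x))"
            by (simp only: powr_add mult.assoc)
          also have "\<dots> \<le> (C4 / L) powr 1 * t powr (- n) * D"
            using C4 L px by (intro mult_mono[OF mult_right_mono[OF powr_mono'] D(2)[OF t0 tR x]]) auto
          also have "\<dots> = C4 * D / (L * t powr n)" using C4 L by (simp add: powr_minus field_simps)
          also have "\<dots> \<le> 1 / (2 * (q * t powr n))"
            using L q t0 C4 by (simp add: field_simps)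
          finally have "\<bar>h x\<bar> powr p x \<le> 1 / (2 * (q * t powr n))" .
          then show ?thesis using 1 x by (auto intro!: add_increasing2 ennreal_leI)
        next
          case 2
          have px: "1 < p x" using one_less_p 2 by simp
          have "2 * (L1 * \<Lambda>) \<le> L * \<Lambda>" using L \<Lambda> by (simp only: mult.assoc[symmetric]) simp
          then have "\<bar>f x\<bar> / (L * \<Lambda>) \<le> \<bar>f x\<bar> / (2 * (L1 * \<Lambda>))"
            using L L1 \<Lambda> by (intro divide_left_mono) auto
          then have "\<bar>h x\<bar> \<le> 1/2 * \<bar>f x / (L1 * \<Lambda>)\<bar>"
            using L L1 \<Lambda> by (simp add: h_far[OF 2] abs_divide abs_mult)
          then have "\<bar>h x\<bar> powr p x \<le> (1/2 * \<bar>f x / (L1 * \<Lambda>)\<bar>) powr p x"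
            using px by (intro powr_mono2) auto
          also have "\<dots> = (1/2) powr p x * \<bar>f x / (L1 * \<Lambda>)\<bar> powr p x" by (intro powr_mult)
          also have "\<dots> \<le> (1/2) powr 1 * \<bar>f x / (L1 * \<Lambda>)\<bar> powr p x"
            using px by (intro mult_right_mono powr_mono') auto
          finally have "ennreal (\<bar>h x\<bar> powr p x) \<le> ennreal (1/2 * \<bar>f x / (L1 * \<Lambda>)\<bar> powr p x)"
            by (intro ennreal_leI) simp
          also have "\<dots> = ennreal (1/2) * ennreal (\<bar>f x / (L1 * \<Lambda>)\<bar> powr p x)" by (rule ennreal_mult) auto
          finally show ?thesis using 2 by (auto intro!: add_increasing)
        next
          case 3
          then show ?thesis using h_else one_less_p[of x] by (cases "x \<in> \<Omega>") auto
        qed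
      qed
      also have "\<dots> = (\<integral>\<^sup>+x. ennreal (1 / (2 * (q * t powr n))) * indicator S x \<partial>lebesgue) +
          (\<integral>\<^sup>+x. ennreal (1/2) * (ennreal (\<bar>f x / (L1 * \<Lambda>)\<bar> powr p x) * indicator (\<Omega> - Q) x) \<partial>lebesgue)"
        by (rule nn_integral_add[OF _ borel_measurable_times_ennreal[OF measurable_const far_meas]]) auto
      also have "\<dots> = ennreal (1 / (2 * (q * t powr n))) * ennreal (q * t powr n) +
          ennreal (1/2) * modular (\<Omega> - Q) (\<lambda>x. f x / (L1 * \<Lambda>))"
        unfolding modular_def nn_integral_cmult_indicator[OF S] nn_integral_cmult[OF far_meas] emS ..
      also have "\<dots> \<le> ennreal (1 / 2) + ennreal (1/2) * 1"
      proof (intro add_mono mult_left_mono)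
        show "ennreal (1 / (2 * (q * t powr n))) * ennreal (q * t powr n) \<le> ennreal (1 / 2)"
          using q t0 by (simp flip: ennreal_mult)
        show "modular (\<Omega> - Q) (\<lambda>x. f x / (L1 * \<Lambda>)) \<le> 1"
          using modular_far_part_le_1[OF t \<eta> cmb] by (simp add: Q_def L1_def \<Lambda>_def)
      qed simp
      also have "\<dots> = ennreal (1 / 2 + 1 / 2)"
        unfolding mult_1_right by (rule ennreal_plus[symmetric]) auto
      also have "\<dots> = 1" by simp
      finally show ?thesis .
    qed
    have dom: "maximal_op \<Omega> f x \<le> ennreal (3 ^ DIM('a) * (L * \<Lambda>)) * maximal_op \<Omega> h x"
      if x: "x \<notin> ball x0 t" for x
    proof -
      let ?F = "\<lambda>y. ennreal \<bar>f y\<bar> * indicator \<Omega> y"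
      let ?H = "\<lambda>y. ennreal \<bar>h y\<bar> * indicator \<Omega> y"
      have F: "?F \<in> borel_measurable lebesgue"
        using f by (intro borel_measurable_times_indicator_subset[OF _ \<Omega>_sets]) auto
      have H: "?H \<in> borel_measurable lebesgue"
        using h by (intro borel_measurable_times_indicator_subset[OF _ \<Omega>_sets]) auto
      have scale: "ennreal (L * \<Lambda>) * ennreal \<bar>y / (L * \<Lambda>)\<bar> = ennreal \<bar>y\<bar>" for y
        using L \<Lambda> by (simp flip: ennreal_mult add: abs_mult)
      have "HL_maximal ?F x \<le> 3 ^ DIM('a) * HL_maximal (\<lambda>y. ennreal (L * \<Lambda>) * ?H y) x"
      proof (rule HL_maximal_le_redistribution[OF F, of _ x0 "t / 2"])
        show "(\<lambda>y. ennreal (L * \<Lambda>) * ?H y) \<in> borel_measurable lebesgue"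
          by (rule borel_measurable_times_ennreal[OF measurable_const H]) simp
        show "?F y \<le> ennreal (L * \<Lambda>) * ?H y" if "y \<notin> ball x0 (t / 2)" for y
          using that scale[of "f y"] h_far[of y] by (cases "y \<in> \<Omega>") (auto simp: Q_def)
        have "(\<integral>\<^sup>+y\<in>ball x0 (t / 2). ?F y \<partial>lebesgue) = ennreal m"
          unfolding m(1)[symmetric] by (intro nn_integral_cong) (auto simp: Q_def split: split_indicator)
        also have "\<dots> = ennreal w * emeasure lebesgue S"
          unfolding emS using w q by (simp flip: ennreal_mult)
        also have "\<dots> = (\<integral>\<^sup>+y. ennreal w * indicator S y \<partial>lebesgue)"
          by (rule nn_integral_cmult_indicator[OF S, symmetric])
        also have "\<dots> \<le> (\<integral>\<^sup>+y\<in>ball x0 (t / 2). ennreal (L * \<Lambda>) * ?H y \<partial>lebesgue)"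
        proof (intro nn_integral_mono)
          fix y
          show "ennreal w * indicator S y \<le> ennreal (L * \<Lambda>) * ?H y * indicator (ball x0 (t / 2)) y"
          proof (cases "y \<in> S")
            case True
            then have "y \<in> \<Omega>" "y \<in> ball x0 (t / 2)" using S\<Omega> SQ by (auto simp: Q_def)
            then show ?thesis using True scale[of w] w h_S[OF True] by simp
          qed simp
        qed
        finally show "(\<integral>\<^sup>+y\<in>ball x0 (t / 2). ?F y \<partial>lebesgue)
          \<le> (\<integral>\<^sup>+y\<in>ball x0 (t / 2). ennreal (L * \<Lambda>) * ?H y \<partial>lebesgue)" .
        show "2 * (t / 2) \<le> dist x0 x" using x by simp
      qed
      also have "\<dots> \<le> 3 ^ DIM('a) * (ennreal (L * \<Lambda>) * HL_maximal ?H x)"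
        by (intro mult_left_mono HL_maximal_cmult_le[OF H]) simp
      also have "(3::ennreal) ^ DIM('a) = ennreal (3 ^ DIM('a))"
        by (metis ennreal_numeral ennreal_power zero_le_numeral)
      also have "ennreal (3 ^ DIM('a)) * (ennreal (L * \<Lambda>) * HL_maximal ?H x)
          = ennreal (3 ^ DIM('a) * (L * \<Lambda>)) * HL_maximal ?H x"
        using L \<Lambda> by (subst ennreal_mult) (auto simp: mult.assoc)
      finally show ?thesis unfolding maximal_op_eq_HL_maximal .
    qed
    have fin: "AE x in lebesgue. maximal_op \<Omega> h x < \<infinity>" by (rule maximal_op_finite_AE[OF h modh])
    have "AE x in lebesgue. x \<in> \<Omega> - ball x0 t \<longrightarrow> maximal_op \<Omega> f x < \<infinity>"
      using fin
    proof eventually_elim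
      fix x assume "maximal_op \<Omega> h x < \<infinity>"
      then show "x \<in> \<Omega> - ball x0 t \<longrightarrow> maximal_op \<Omega> f x < \<infinity>"
        using dom[of x] by (auto intro: le_less_trans simp: ennreal_mult_less_top)
    qed
    moreover have "modular (\<Omega> - ball x0 t) (\<lambda>x. enn2real (maximal_op \<Omega> f x) / (K * \<Lambda>)) \<le> 1"
    proof -
      have "modular (\<Omega> - ball x0 t) (\<lambda>x. enn2real (maximal_op \<Omega> f x) / (K * \<Lambda>))
          \<le> modular \<Omega> (\<lambda>x. enn2real (maximal_op \<Omega> h x) / KM)"
        unfolding modular_def
      proof (rule nn_integral_mono_AE)
        show "AE x in lebesgue.
           ennreal (\<bar>enn2real (maximal_op \<Omega> f x) / (K * \<Lambda>)\<bar> powr p x) * indicator (\<Omega> - ball x0 t) x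
           \<le> ennreal (\<bar>enn2real (maximal_op \<Omega> h x) / KM\<bar> powr p x) * indicator \<Omega> x"
          using fin
        proof eventually_elim
          fix x assume fin_x: "maximal_op \<Omega> h x < \<infinity>"
          show "ennreal (\<bar>enn2real (maximal_op \<Omega> f x) / (K * \<Lambda>)\<bar> powr p x) * indicator (\<Omega> - ball x0 t) x
           \<le> ennreal (\<bar>enn2real (maximal_op \<Omega> h x) / KM\<bar> powr p x) * indicator \<Omega> x"
          proof (cases "x \<in> \<Omega> - ball x0 t")
            case True
            define a where "a = enn2real (maximal_op \<Omega> h x)"
            have a: "maximal_op \<Omega> h x = ennreal a" "0 \<le> a" using fin_x by (auto simp: a_def)
            define c where "c = 3 ^ DIM('a) * (L * \<Lambda>)"
            have c: "0 < c" using L \<Lambda> by (simp add: c_def)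
            have "maximal_op \<Omega> f x \<le> ennreal (c * a)"
              using dom[of x] True a c by (simp add: c_def[symmetric] ennreal_mult)
            then have "enn2real (maximal_op \<Omega> f x) \<le> c * a" using a c by (intro enn2real_leI) auto
            then have "enn2real (maximal_op \<Omega> f x) / (K * \<Lambda>) \<le> c * a / (K * \<Lambda>)"
              using \<open>0 < K\<close> \<Lambda> by (intro divide_right_mono) auto
            also have "\<dots> = a / KM" using L \<Lambda> KM by (simp add: c_def K_def)
            finally have "\<bar>enn2real (maximal_op \<Omega> f x) / (K * \<Lambda>)\<bar> \<le> \<bar>a / KM\<bar>"
              using \<open>0 < K\<close> \<Lambda> a KM by simp
            then have "\<bar>enn2real (maximal_op \<Omega> f x) / (K * \<Lambda>)\<bar> powr p x \<le> \<bar>a / KM\<bar> powr p x"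
              using one_less_p[of x] True by (intro powr_mono2) auto
            then show ?thesis using True by (simp add: a_def ennreal_leI)
          qed simp
        qed
      qed
      also have "\<dots> \<le> 1" by (rule KM(2)[OF h modh])
      finally show ?thesis .
    qed
    ultimately show "(AE x in lebesgue. x \<in> \<Omega> - ball x0 t \<longrightarrow> maximal_op \<Omega> f x < \<infinity>) \<and>
          modular (\<Omega> - ball x0 t)
            (\<lambda>x. enn2real (maximal_op \<Omega> f x) / (K * (\<eta> * \<omega>2 t * t powr (- \<beta>)))) \<le> 1"
      by (simp add: \<Lambda>_def)
  qed
qed

text \<open>The strict inequality is needed because the infimum in the Luxemburg norm is only approached, not known to be
attained; it is removed at the end by letting \<open>\<eta>\<close> decrease to the norm.\<close>
lemma complement_modular_bounded_of_norm_less: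
  assumes "compl_morrey_norm p \<omega>1 x0 \<Omega> f < ennreal \<eta>"
  shows "complement_modular_bounded f \<eta>"
  unfolding complement_modular_bounded_def
proof
  fix s assume s: "s \<in> {0<..<diameter \<Omega>}"
  have w: "0 < \<omega>1 s" using \<omega>1_pos[OF s] .
  define a where "a = s powr \<beta> / \<omega>1 s"
  have a: "0 < a" using s w by (simp add: a_def)
  let ?N = "luxemburg_norm p (\<Omega> - ball x0 s) f"
  have eq: "\<Omega> - (ball x0 s \<inter> \<Omega>) = \<Omega> - ball x0 s" by auto
  have "ennreal a * ?N \<le> compl_morrey_norm p \<omega>1 x0 \<Omega> f"
    unfolding compl_morrey_norm_def n_def[symmetric] \<beta>_def[symmetric]
    by (rule SUP_upper2[OF s]) (simp add: eq a_def)
  with assms have less: "ennreal a * ?N < ennreal \<eta>" by (rule order.strict_trans1[rotated])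
  have "?N < ennreal (\<eta> * \<omega>1 s * s powr (- \<beta>))"
  proof (rule ccontr)
    assume "\<not> ?N < ennreal (\<eta> * \<omega>1 s * s powr (- \<beta>))"
    then have "ennreal a * ennreal (\<eta> * \<omega>1 s * s powr (- \<beta>)) \<le> ennreal a * ?N"
      by (intro mult_left_mono) auto
    moreover have "ennreal a * ennreal (\<eta> * \<omega>1 s * s powr (- \<beta>)) = ennreal (a * (\<eta> * \<omega>1 s * s powr (- \<beta>)))"
      using a by (rule ennreal_mult'[symmetric, OF less_imp_le])
    moreover have "a * (\<eta> * \<omega>1 s * s powr (- \<beta>)) = \<eta>"
      using s w by (simp add: a_def powr_minus)
    ultimately show False using less by simp
  qed
  then show "modular (\<Omega> - ball x0 s) (\<lambda>x. f x / (\<eta> * \<omega>1 s * s powr (- \<beta>))) \<le> 1"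
    by (rule modular_le_of_luxemburg_norm_less[rotated]) auto
qed

lemma compl_morrey_norm_le:
  assumes \<eta>: "0 < \<eta>"
    and mod: "\<And>t. t \<in> {0<..<diameter \<Omega>}
      \<Longrightarrow> modular (\<Omega> - ball x0 t) (\<lambda>x. g x / (\<eta> * \<omega>2 t * t powr (- \<beta>))) \<le> 1"
  shows "compl_morrey_norm p \<omega>2 x0 \<Omega> g \<le> ennreal \<eta>"
  unfolding compl_morrey_norm_def n_def[symmetric] \<beta>_def[symmetric]
proof (rule SUP_least)
  fix t assume t: "t \<in> {0<..<diameter \<Omega>}"
  have w: "0 < \<omega>2 t" using \<omega>2_pos[OF t] .
  have eq: "\<Omega> - (ball x0 t \<inter> \<Omega>) = \<Omega> - ball x0 t" by auto
  have "ennreal (t powr \<beta> / \<omega>2 t) * luxemburg_norm p (\<Omega> - ball x0 t) g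
      \<le> ennreal (t powr \<beta> / \<omega>2 t) * ennreal (\<eta> * \<omega>2 t * t powr (- \<beta>))"
    using \<eta> w t mod[OF t] by (intro mult_left_mono luxemburg_norm_le) auto
  also have "\<dots> = ennreal (t powr \<beta> / \<omega>2 t * (\<eta> * \<omega>2 t * t powr (- \<beta>)))"
    using \<eta> w by (intro ennreal_mult[symmetric]) auto
  also have "t powr \<beta> / \<omega>2 t * (\<eta> * \<omega>2 t * t powr (- \<beta>)) = \<eta>"
    using t w by (simp add: powr_minus)
  finally show "ennreal (t powr \<beta> / \<omega>2 t) * luxemburg_norm p (\<Omega> - (ball x0 t \<inter> \<Omega>)) g \<le> ennreal \<eta>"
    by (simp only: eq)
qed

lemma diameter_pos: "0 < diameter \<Omega>"
proof -
  obtain e where e: "0 < e" "ball x0 e \<subseteq> \<Omega>" using open_\<Omega> x0 by (meson open_contains_ball)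
  have "diameter (ball x0 e) \<le> diameter \<Omega>" using e bounded_\<Omega> by (intro diameter_subset)
  then show ?thesis using e by (simp add: diameter_ball)
qed

theorem maximal_op_bounded_complementary_Morrey: "maximal_op_bounded p x0 \<Omega> \<omega>1 \<omega>2"
proof -
  obtain K where K: "0 < K"
    "\<And>f \<eta> t. \<lbrakk>f \<in> borel_measurable (lebesgue_on \<Omega>); 0 < \<eta>; complement_modular_bounded f \<eta>;
        t \<in> {0<..<diameter \<Omega>}\<rbrakk>
      \<Longrightarrow> (AE x in lebesgue. x \<in> \<Omega> - ball x0 t \<longrightarrow> maximal_op \<Omega> f x < \<infinity>) \<and>
          modular (\<Omega> - ball x0 t)
            (\<lambda>x. enn2real (maximal_op \<Omega> f x) / (K * (\<eta> * \<omega>2 t * t powr (- \<beta>)))) \<le> 1"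
    by (rule maximal_op_complement_bound) (blast intro: that)
  show ?thesis
    unfolding maximal_op_bounded_def
  proof (intro exI[of _ K] conjI ballI)
    show "0 < K" by fact
    fix f assume "f \<in> compl_morrey_space p \<omega>1 x0 \<Omega>"
    then have f: "f \<in> borel_measurable (lebesgue_on \<Omega>)" and "compl_morrey_norm p \<omega>1 x0 \<Omega> f < \<infinity>"
      by (auto simp: compl_morrey_space_def)
    then obtain N where N: "0 \<le> N" "compl_morrey_norm p \<omega>1 x0 \<Omega> f = ennreal N"
      by (cases "compl_morrey_norm p \<omega>1 x0 \<Omega> f") auto
    let ?M = "\<lambda>x. enn2real (maximal_op \<Omega> f x)"
    have cmb: "complement_modular_bounded f \<eta>" if "N < \<eta>" for \<eta>
      using that N by (intro complement_modular_bounded_of_norm_less) (simp add: ennreal_less_iff)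
    have bound: "compl_morrey_norm p \<omega>2 x0 \<Omega> ?M \<le> ennreal (K * \<eta>)" if \<eta>: "N < \<eta>" for \<eta>
    proof (rule compl_morrey_norm_le)
      show "0 < K * \<eta>" using K \<eta> N by simp
      fix t assume t: "t \<in> {0<..<diameter \<Omega>}"
      have "0 < \<eta>" using \<eta> N by simp
      then show "modular (\<Omega> - ball x0 t) (\<lambda>x. ?M x / (K * \<eta> * \<omega>2 t * t powr (- \<beta>))) \<le> 1"
        using K(2)[OF f _ cmb[OF \<eta>] t] by (simp add: mult.assoc)
    qed
    have norm: "compl_morrey_norm p \<omega>2 x0 \<Omega> ?M \<le> ennreal K * compl_morrey_norm p \<omega>1 x0 \<Omega> f"
    proof (rule ennreal_le_epsilon)
      fix e :: real assume e: "0 < e"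
      have "compl_morrey_norm p \<omega>2 x0 \<Omega> ?M \<le> ennreal (K * (N + e / K))"
        using e K by (intro bound) simp
      also have "K * (N + e / K) = K * N + e" using K by (simp add: distrib_left)
      also have "ennreal (K * N + e) = ennreal K * ennreal N + ennreal e"
        using K N e by (simp add: ennreal_plus ennreal_mult)
      finally show "compl_morrey_norm p \<omega>2 x0 \<Omega> ?M \<le> ennreal K * compl_morrey_norm p \<omega>1 x0 \<Omega> f + ennreal e"
        by (simp add: N)
    qed
    then show "compl_morrey_norm p \<omega>2 x0 \<Omega> ?M \<le> ennreal K * compl_morrey_norm p \<omega>1 x0 \<Omega> f" .
    have F: "(\<lambda>y. ennreal \<bar>f y\<bar> * indicator \<Omega> y) \<in> borel_measurable lebesgue"
      using f by (intro borel_measurable_times_indicator_subset[OF _ \<Omega>_sets]) auto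
    have "maximal_op \<Omega> f \<in> borel_measurable lebesgue"
      unfolding maximal_op_eq_HL_maximal
      using borel_measurable_HL_maximal[OF F] by (intro measurable_completion) simp
    then have "?M \<in> borel_measurable (lebesgue_on \<Omega>)"
      by (intro measurable_restrict_space1) measurable
    moreover have "compl_morrey_norm p \<omega>2 x0 \<Omega> ?M < \<infinity>"
      using norm by (rule le_less_trans) (simp add: N ennreal_mult_less_top)
    ultimately show "?M \<in> compl_morrey_space p \<omega>2 x0 \<Omega>" by (simp add: compl_morrey_space_def)
    \<comment> \<open>The complements of the balls of these radii exhaust \<open>\<Omega>\<close> up to the null set \<open>{x0}\<close>.\<close>
    define t where "t k = diameter \<Omega> / (real k + 2)" for k :: nat
    have t: "t k \<in> {0<..<diameter \<Omega>}" for k using diameter_pos by (auto simp: t_def field_simps add_pos_nonneg)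
    have "AE x in lebesgue. x \<in> \<Omega> - ball x0 (t k) \<longrightarrow> maximal_op \<Omega> f x < \<infinity>" for k
      using K(2)[OF f _ cmb[of "N + 1"] t[of k]] N by simp
    then have "AE x in lebesgue. \<forall>k. x \<in> \<Omega> - ball x0 (t k) \<longrightarrow> maximal_op \<Omega> f x < \<infinity>"
      by (subst AE_all_countable) blast
    moreover have "AE x in lebesgue. x \<noteq> x0"
      by (intro AE_I'[of "{x0}"]) (auto simp: negligible_iff_null_sets[symmetric])
    ultimately have "AE x in lebesgue. x \<in> \<Omega> \<longrightarrow> maximal_op \<Omega> f x < \<infinity>"
    proof eventually_elim
      fix x assume *: "\<forall>k. x \<in> \<Omega> - ball x0 (t k) \<longrightarrow> maximal_op \<Omega> f x < \<infinity>" and "x \<noteq> x0"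
      then have d: "0 < dist x0 x" by simp
      obtain k :: nat where "diameter \<Omega> / dist x0 x < real k" using reals_Archimedean2 by blast
      then have "diameter \<Omega> < real k * dist x0 x" using d by (simp add: divide_less_eq)
      also have "\<dots> \<le> (real k + 2) * dist x0 x" using d by (intro mult_right_mono) auto
      finally have "t k \<le> dist x0 x" by (simp add: t_def divide_le_eq mult.commute)
      then show "x \<in> \<Omega> \<longrightarrow> maximal_op \<Omega> f x < \<infinity>" using *[rule_format, of k] by auto
    qed
    then show "AE x in lebesgue_on \<Omega>. maximal_op \<Omega> f x < \<infinity>"
      by (subst AE_restrict_space_iff) auto
  qed
qed

end

theorem theorem5p2:
  fixes \<Omega> :: "'a::euclidean_space set" and x0 :: 'a
    and p :: "'a \<Rightarrow> real" and \<omega>1 \<omega>2 :: "real \<Rightarrow> real"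
  assumes "open \<Omega>" and "bounded \<Omega>" and "x0 \<in> \<Omega>"
    and "p \<in> borel_measurable (lebesgue_on \<Omega>)"
    and "p \<in> WL \<Omega>"
    and "1 < ess_inf_on \<Omega> p"
    and "\<forall>x\<in>\<Omega>. ess_inf_on \<Omega> p \<le> ereal (p x) \<and> ereal (p x) \<le> ess_sup_on \<Omega> p"
    and "ess_sup_on \<Omega> p < \<infinity>"
    and "admissible_weight p \<Omega> x0 \<omega>1"
    and "admissible_weight p \<Omega> x0 \<omega>2"
    and "\<exists>C::real. C > 0 \<and> (\<forall>t\<in>{0<..<diameter \<Omega>}.
           (\<integral>\<^sup>+r\<in>{0<..<t}. ennreal (\<omega>1 r / r) \<partial>lebesgue) \<le> ennreal (C * \<omega>2 t))"
  shows "maximal_op_bounded p x0 \<Omega> \<omega>1 \<omega>2"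
proof -
  obtain A where A: "A > 0" "\<And>x y. \<lbrakk>x \<in> \<Omega>; y \<in> \<Omega>; norm (x - y) \<le> 1/2\<rbrakk>
      \<Longrightarrow> \<bar>p x - p y\<bar> \<le> A / (- ln (norm (x - y)))"
    using \<open>p \<in> WL \<Omega>\<close> unfolding WL_def by blast
  obtain C where C: "C > 0" "\<And>t. t \<in> {0<..<diameter \<Omega>} \<Longrightarrow>
      (\<integral>\<^sup>+r\<in>{0<..<t}. ennreal (\<omega>1 r / r) \<partial>lebesgue) \<le> ennreal (C * \<omega>2 t)"
    using assms(11) by blast
  obtain pm where pm: "ess_inf_on \<Omega> p = ereal pm"
    using assms(3,6,7) by (cases "ess_inf_on \<Omega> p") auto
  obtain pM where pM: "ess_sup_on \<Omega> p = ereal pM"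
    using assms(3,7,8) by (cases "ess_sup_on \<Omega> p") auto
  interpret complementary_Morrey_weights \<Omega> p pm pM A x0 \<omega>1 \<omega>2 C
  proof unfold_locales
    show "1 < pm" using assms(6) pm by (simp add: one_ereal_def)
    show "pm \<le> p x" "p x \<le> pM" if "x \<in> \<Omega>" for x using assms(7) pm pM that by auto
    show "\<omega>1 \<in> borel_measurable (lebesgue_on {0<..<diameter \<Omega>})"
      using assms(9) by (simp add: admissible_weight_def weight_function_def)
    show "0 < \<omega>1 r" "0 < \<omega>2 r" if "r \<in> {0<..<diameter \<Omega>}" for r
      using assms(9,10) that by (auto simp: admissible_weight_def)
  qed (use assms A C in auto)
  show ?thesis by (rule maximal_op_bounded_complementary_Morrey)
qed

end
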